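(* Assume $E[\omega(0)]<\infty$. Then there exists a constant $0<\alpha<1$ such that for all $\epsilon>0$, \[ \limsup_{\|x\|_1 \to \infty} \frac{1}{\|x\|_1^{\alpha}} \log \bar{P}\bigl(T(0,x) \leq (1-\epsilon)\mu(x)\bigr)<0, \] where the limit superior is over $x\in\mathbb{Z}^d$.
   Context: Let $d \geq 2$. Let $\omega=(\omega(x))_{x \in \mathbb{Z}^d}$ be independent random variables with a common law on $\mathbb{N}_0=\{0,1,2,\dots\}$, not concentrated at $0$. Independently of $\omega$, let $(S_k(x,\ell))_{k \geq 0}$, $x \in \mathbb{Z}^d$, $\ell \in \mathbb{N}$, be independent simple random walks on $\mathbb{Z}^d$ with $S_0(x,\ell)=x$. For $x,y \in \mathbb{Z}^d$ let $\tau(x,y):=\inf\{k \geq 0: S_k(x,\ell)=y \text{ for some } 1 \leq \ell \leq \omega(x)\}$, with $\tau(x,y):=\infty$ if $\omega(x)=0$, and define the first passage time $T(x,y):=\inf\{\sum_{i=0}^{m-1}\tau(x_i,x_{i+1}): m \geq 1,\ x=x_0,x_1,\dots,x_m=y \in \mathbb{Z}^d\}$. Write $\bar{P}:=P(\cdot \mid \omega(0) \geq 1)$ and $\|\cdot\|_1$ for the $\ell^1$-norm. The time constant $\mu(\cdot)$ is the (deterministic) norm on $\mathbb{R}^d$ such that almost surely on $\{\omega(0)\ge 1\}$, $\lim_{\|x\|_1\to\infty}(T(0,x)-\mu(x))/\|x\|_1=0$ (its existence is known). *)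

theory Defs
  imports "HOL-Probability.Probability"
begin

definition norm1 :: "int^'d \<Rightarrow> real" where
  "norm1 x = (\<Sum>i\<in>UNIV. real_of_int \<bar>x $ i\<bar>)"

definition lat_to_real :: "int^'d \<Rightarrow> real^'d" where
  "lat_to_real x = (\<chi> i. real_of_int (x $ i))"

definition l1_at_infinity :: "(int^'d) filter" where
  "l1_at_infinity = (INF n::real. principal {x. norm1 x \<ge> n})"

text \<open>Hitting time tau(x,y): om is the realisation of omega, S x l k the
  position at time k of the l-th walk started at x. Inf {} = infinity.\<close>
definition tau :: "(int^'d \<Rightarrow> nat) \<Rightarrow> (int^'d \<Rightarrow> nat \<Rightarrow> nat \<Rightarrow> int^'d)
    \<Rightarrow> int^'d \<Rightarrow> int^'d \<Rightarrow> enat" where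
  "tau om S x y = Inf {enat k | k. \<exists>l. 1 \<le> l \<and> l \<le> om x \<and> S x l k = y}"

definition fpt :: "(int^'d \<Rightarrow> nat) \<Rightarrow> (int^'d \<Rightarrow> nat \<Rightarrow> nat \<Rightarrow> int^'d)
    \<Rightarrow> int^'d \<Rightarrow> int^'d \<Rightarrow> enat" where
  "fpt om S x y = Inf {(\<Sum>i<m. tau om S (p i) (p (Suc i))) | m p.
       1 \<le> m \<and> p 0 = x \<and> p m = y}"

definition eln :: "real \<Rightarrow> ereal" where
  "eln p = (if p = 0 then -\<infinity> else ereal (ln p))"

definition basic_rvs :: "('a \<Rightarrow> int^'d \<Rightarrow> nat) \<Rightarrow> ('a \<Rightarrow> int^'d \<Rightarrow> nat \<Rightarrow> nat \<Rightarrow> int^'d)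
    \<Rightarrow> ((int^'d) + ((int^'d) \<times> nat \<times> nat)) \<Rightarrow> 'a \<Rightarrow> nat + (int^'d)" where
  "basic_rvs \<omega> S i w = (case i of Inl x \<Rightarrow> Inl (\<omega> w x)
      | Inr (x, l, k) \<Rightarrow> Inr (S w x l (Suc k) - S w x l k))"

end

theory Submission
  imports Defs "HOL-Real_Asymp.Real_Asymp"
begin

text \<open>Write \<open>n\<close> for the norm of \<open>x\<close> and work on the scale \<open>K\<close> of order \<open>n powr (3/4)\<close>. Since
  \<open>K\<^sup>2 / n\<close> is of order \<open>n powr (1/2)\<close>, Hoeffding's inequality and the first moment of the number
  of frogs per site show that, up to probability \<open>exp (- n powr (1/4) / 2)\<close>, no frog within distance
  \<open>O(n)\<close> of the origin moves by \<open>K\<close> within time \<open>O(n)\<close>. A fast passage from \<open>0\<close> to \<open>x\<close> then has a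
  skeleton of at most \<open>O(n / K)\<close> points, consecutive ones at distance between \<open>K\<close> and \<open>2 K\<close> and
  lying in distinct blocks of side of order \<open>K\<close>. A block is good if the passage times from some
  site close to it agree with the time constant up to a small relative error; by subadditivity,
  leaving a good block then takes about the time predicted by the time constant. So a positive
  fraction of the blocks of the skeleton must be bad. By the shape theorem bad blocks have small
  probability, without any rate, and they are finite-range dependent because walks have speed at most
  one. Summing over the exponentially many (in \<open>n / K\<close>) sequences of neighbouring blocks gives a
  bound \<open>exp (- c n / K)\<close>, and \<open>n / K\<close> is of order \<open>n powr (1/4)\<close>.\<close>

text \<open>The power of K is a compromise: a larger K leaves fewer blocks to pay with, a smaller
  one weakens Hoeffding's inequality. With only a first moment, Markov's inequality truncates the
  frogs of a site at exp (n / K) at the price of a failure probability of order exp (- n / K); the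
  union bound over that many walks then needs K^2 / n to dominate n / K. For K = n powr p this means
  p > 2/3, and the resulting rate is n powr (1 - p). Another obstacle is that a path enters a block
  at a site about which nothing is known. A lower bound on the time from there comes from
  subadditivity read backwards, T(z,y) \<ge> T(w,y) - T(w,z), with a fixed site w close to z whose
  passage times are controlled from both sides. As w may be empty, each block offers several
  candidates, and only their joint failure makes it bad. Finally, the entropy of the chains and the
  dependence range, measured in blocks, are governed by the ratio H of K to the block side s and not
  by s itself. So it is known how rare bad blocks must be before s is chosen, and convergence
  without a rate suffices.\<close>

section \<open>The l1-norm on the integer lattice\<close>

lemma norm1_nonneg [simp]: "0 \<le> norm1 x"
  by (simp add: norm1_def sum_nonneg)

lemma norm1_zero [simp]: "norm1 0 = 0"
  by (simp add: norm1_def)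

lemma norm1_minus: "norm1 (- x) = norm1 x"
  by (simp add: norm1_def)

lemma norm1_minus_commute: "norm1 (x - y) = norm1 (y - x)"
  using norm1_minus[of "x - y"] by simp

lemma norm1_triangle: "norm1 (x + y) \<le> norm1 x + norm1 y"
  unfolding norm1_def sum.distrib[symmetric] by (intro sum_mono) auto

lemma norm1_triangle_diff: "norm1 (x - z) \<le> norm1 (x - y) + norm1 (y - z)"
  using norm1_triangle[of "x - y" "y - z"] by simp

lemma abs_coord_le_norm1: "real_of_int \<bar>x $ i\<bar> \<le> norm1 x"
  unfolding norm1_def using member_le_sum[of i UNIV "\<lambda>i. real_of_int \<bar>x $ i\<bar>"] by simp

lemma norm1_le_card:
  fixes x :: "int^'d"
  assumes "\<And>i. real_of_int \<bar>x $ i\<bar> \<le> c"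
  shows "norm1 x \<le> real CARD('d) * c"
  unfolding norm1_def using sum_bounded_above[of UNIV "\<lambda>i. real_of_int \<bar>x $ i\<bar>" c] assms by simp

lemma norm1_ge_iff_coord:
  fixes x :: "int^'d"
  assumes "norm1 x \<ge> c"
  obtains i where "real_of_int \<bar>x $ i\<bar> \<ge> c / real CARD('d)"
proof (rule ccontr)
  assume "\<not> thesis"
  then have *: "real_of_int \<bar>x $ i\<bar> < c / real CARD('d)" for i
    using that[of i] by (metis not_le \<open>\<not> thesis\<close>)
  have "norm1 x < (\<Sum>i\<in>(UNIV::'d set). c / real CARD('d))"
    unfolding norm1_def by (intro sum_strict_mono *) auto
  with assms show False by simp
qed

lemma vec_set_conv:
  "{x :: int^'d. \<forall>i. x $ i \<in> F i} = vec_lambda ` (Pi\<^sub>E UNIV F)"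
proof (intro equalityI subsetI)
  fix x :: "int^'d" assume "x \<in> {x. \<forall>i. x $ i \<in> F i}"
  then have "(\<lambda>i. x $ i) \<in> Pi\<^sub>E UNIV F" "x = vec_lambda (\<lambda>i. x $ i)" by auto
  then show "x \<in> vec_lambda ` (Pi\<^sub>E UNIV F)" by blast
qed (auto simp: PiE_iff)

lemma card_vec_box:
  assumes "\<And>i. finite (F i)"
  shows "finite {x :: int^'d. \<forall>i. x $ i \<in> F i}"
    and "card {x :: int^'d. \<forall>i. x $ i \<in> F i} = (\<Prod>i\<in>UNIV. card (F i))"
  unfolding vec_set_conv using assms
  by (simp_all add: card_image inj_on_def vec_lambda_inject card_PiE finite_PiE)

lemma norm1_cball_subset:
  "{x :: int^'d. norm1 (x - a) \<le> real r} \<subseteq> {x. \<forall>i. x $ i \<in> {a $ i - int r..a $ i + int r}}"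
proof clarify
  fix x :: "int^'d" and i
  assume "norm1 (x - a) \<le> real r"
  then have "real_of_int \<bar>(x - a) $ i\<bar> \<le> real r"
    using abs_coord_le_norm1[of "x - a" i] by linarith
  then show "x $ i \<in> {a $ i - int r..a $ i + int r}" by auto
qed

lemma finite_norm1_cball: "finite {x :: int^'d. norm1 (x - a) \<le> r}"
proof (rule finite_subset)
  have "r \<le> real (nat \<lceil>r\<rceil>)" by linarith
  then show "{x :: int^'d. norm1 (x - a) \<le> r} \<subseteq> {x. norm1 (x - a) \<le> real (nat \<lceil>r\<rceil>)}" by auto
  show "finite {x. norm1 (x - a) \<le> real (nat \<lceil>r\<rceil>)}"
    by (rule finite_subset[OF norm1_cball_subset]) (rule card_vec_box, simp)
qed

lemma card_norm1_cball_le: "card {x :: int^'d. norm1 (x - a) \<le> real r} \<le> (2 * r + 1) ^ CARD('d)"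
proof -
  have "card {x :: int^'d. norm1 (x - a) \<le> real r}
      \<le> card {x :: int^'d. \<forall>i. x $ i \<in> {a $ i - int r..a $ i + int r}}"
    by (rule card_mono[OF _ norm1_cball_subset]) (rule card_vec_box, simp)
  also have "\<dots> = (2 * r + 1) ^ CARD('d)"
    by (subst card_vec_box) (simp_all add: nat_add_distrib nat_mult_distrib algebra_simps)
  finally show ?thesis .
qed

section \<open>First passage times\<close>

text \<open>A nonempty set of extended naturals attains its infimum. Bounds on \<open>tau\<close>
  and \<open>fpt\<close> therefore come with an actual frog or an actual path, without
  approximation.\<close>

lemma Inf_enat_le_iff:
  fixes A :: "enat set"
  shows "Inf A \<le> enat k \<longleftrightarrow> (\<exists>a\<in>A. a \<le> enat k)"
proof
  assume *: "Inf A \<le> enat k"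
  then have "A \<noteq> {}" by (auto simp: Inf_enat_def)
  then have "Inf A \<in> A" unfolding Inf_enat_def by (auto intro: LeastI)
  with * show "\<exists>a\<in>A. a \<le> enat k" by blast
qed (meson Inf_lower order_trans)

lemma tau_le_iff:
  "tau om S x y \<le> enat k \<longleftrightarrow> (\<exists>j\<le>k. \<exists>l. 1 \<le> l \<and> l \<le> om x \<and> S x l j = y)"
proof -
  have "(\<exists>a\<in>{enat j | j. Q j}. a \<le> enat k) \<longleftrightarrow> (\<exists>j\<le>k. Q j)" for Q
    by auto
  then show ?thesis unfolding tau_def Inf_enat_le_iff .
qed

lemma fpt_le_iff:
  "fpt om S x y \<le> enat k \<longleftrightarrow>
    (\<exists>m p. 1 \<le> m \<and> p 0 = x \<and> p m = y \<and> (\<Sum>i<m. tau om S (p i) (p (Suc i))) \<le> enat k)"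
  unfolding fpt_def Inf_enat_le_iff by blast

lemma enat_le_by_finite:
  fixes a b :: enat
  assumes "\<And>k. b \<le> enat k \<Longrightarrow> a \<le> enat k"
  shows "a \<le> b"
  using assms by (cases b) auto

text \<open>Only labels \<open>1 \<le> l\<close> are constrained: frogs are numbered from 1, and no
  law is prescribed for the increments of \<open>S x 0\<close>.\<close>

definition nearest_neighbour :: "(int^'d \<Rightarrow> nat \<Rightarrow> nat \<Rightarrow> int^'d) \<Rightarrow> bool" where
  "nearest_neighbour S \<longleftrightarrow>
     (\<forall>x l. 1 \<le> l \<longrightarrow> S x l 0 = x \<and> (\<forall>k. norm1 (S x l (Suc k) - S x l k) = 1))"

lemma nearest_neighbour_dist:
  assumes "nearest_neighbour S" "1 \<le> l"
  shows "norm1 (S x l k - x) \<le> real k"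
proof (induction k)
  case (Suc k)
  have "norm1 (S x l (Suc k) - x) \<le> norm1 (S x l (Suc k) - S x l k) + norm1 (S x l k - x)"
    by (rule norm1_triangle_diff)
  with Suc assms show ?case by (simp add: nearest_neighbour_def)
qed (use assms in \<open>simp add: nearest_neighbour_def\<close>)

lemma norm1_le_tau:
  assumes "nearest_neighbour S" "tau om S x y \<le> enat k"
  shows "norm1 (y - x) \<le> real k"
proof -
  from assms(2) obtain j l where "j \<le> k" "1 \<le> l" "S x l j = y"
    unfolding tau_le_iff by blast
  then show ?thesis using nearest_neighbour_dist[OF assms(1), of l x j] by simp
qed

lemma norm1_le_path_cost:
  assumes "nearest_neighbour S" "(\<Sum>i<m. tau om S (p i) (p (Suc i))) \<le> enat k"
  shows "norm1 (p m - p 0) \<le> real k"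
  using assms(2)
proof (induction m arbitrary: k)
  case (Suc m)
  obtain a b where a: "(\<Sum>i<m. tau om S (p i) (p (Suc i))) = enat a"
    and b: "tau om S (p m) (p (Suc m)) = enat b" and "a + b \<le> k"
    using Suc.prems
    by (cases "\<Sum>i<m. tau om S (p i) (p (Suc i))"; cases "tau om S (p m) (p (Suc m))") auto
  have "norm1 (p (Suc m) - p 0) \<le> norm1 (p (Suc m) - p m) + norm1 (p m - p 0)"
    by (rule norm1_triangle_diff)
  also have "\<dots> \<le> real b + real a"
    using Suc.IH[of a] norm1_le_tau[OF assms(1), of om "p m" "p (Suc m)" b] a b by simp
  finally show ?case using \<open>a + b \<le> k\<close> by simp
qed simp

lemma norm1_le_fpt:
  assumes "nearest_neighbour S" "fpt om S x y \<le> enat k"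
  shows "norm1 (y - x) \<le> real k"
  using norm1_le_path_cost[OF assms(1)] assms(2) unfolding fpt_le_iff by metis

text \<open>Strictness of \<open>i < j\<close> matters: a path has at least one leg, and from an
  empty site even the passage to itself takes infinite time, whereas an empty sum is 0.\<close>

lemma fpt_le_path_cost:
  assumes "i < j"
  shows "fpt om S (p i) (p j) \<le> (\<Sum>k\<in>{i..<j}. tau om S (p k) (p (Suc k)))"
proof -
  have "(\<Sum>k\<in>{i..<j}. tau om S (p k) (p (Suc k)))
      = (\<Sum>k<j - i. tau om S (p (i + k)) (p (Suc (i + k))))"
    using assms
    by (intro sum.reindex_bij_witness[of _ "\<lambda>k. i + k" "\<lambda>k. k - i"]) auto
  moreover have "fpt om S (p i) (p j) \<le> (\<Sum>k<j - i. tau om S (p (i + k)) (p (Suc (i + k))))"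
    unfolding fpt_def using assms
    by (intro Inf_lower) (auto intro!: exI[of _ "j - i"] exI[of _ "\<lambda>k. p (i + k)"])
  ultimately show ?thesis by simp
qed

lemma fpt_triangle: "fpt om S x z \<le> fpt om S x y + fpt om S y z"
proof (rule enat_le_by_finite)
  fix k assume "fpt om S x y + fpt om S y z \<le> enat k"
  then obtain a b where ab: "fpt om S x y \<le> enat a" "fpt om S y z \<le> enat b" "a + b \<le> k"
    by (cases "fpt om S x y"; cases "fpt om S y z") auto
  obtain m p where p: "1 \<le> m" "p 0 = x" "p m = y"
    "(\<Sum>i<m. tau om S (p i) (p (Suc i))) \<le> enat a"
    using ab(1) unfolding fpt_le_iff by blast
  obtain m' p' where p': "1 \<le> m'" "p' 0 = y" "p' m' = z"
    "(\<Sum>i<m'. tau om S (p' i) (p' (Suc i))) \<le> enat b"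
    using ab(2) unfolding fpt_le_iff by blast
  define q where "q i = (if i \<le> m then p i else p' (i - m))" for i
  have "(\<Sum>i<m + m'. tau om S (q i) (q (Suc i)))
      = (\<Sum>i<m. tau om S (q i) (q (Suc i))) + (\<Sum>i<m'. tau om S (q (m + i)) (q (Suc (m + i))))"
    by (induction m') (auto simp: add_ac)
  also have "(\<Sum>i<m. tau om S (q i) (q (Suc i))) = (\<Sum>i<m. tau om S (p i) (p (Suc i)))"
    by (intro sum.cong) (auto simp: q_def)
  also have "(\<Sum>i<m'. tau om S (q (m + i)) (q (Suc (m + i))))
      = (\<Sum>i<m'. tau om S (p' i) (p' (Suc i)))"
    using p p' by (intro sum.cong) (auto simp: q_def)
  finally have "(\<Sum>i<m + m'. tau om S (q i) (q (Suc i))) \<le> enat a + enat b"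
    using add_mono[OF p(4) p'(4)] by simp
  also have "\<dots> \<le> enat k" using ab(3) by simp
  finally show "fpt om S x z \<le> enat k"
    unfolding fpt_le_iff using p p'
    by (intro exI[of _ "m + m'"] exI[of _ q]) (auto simp: q_def)
qed

text \<open>Walks of absent frogs, and label 0, are never consulted. This allows a configuration
  with default values to stand in for the given walks.\<close>

lemma fpt_cong:
  assumes "\<And>x. om x = om' x" "\<And>x l k. 1 \<le> l \<Longrightarrow> l \<le> om x \<Longrightarrow> S x l k = S' x l k"
  shows "fpt om S = fpt om' S'"
proof -
  have "tau om S = tau om' S'"
  proof (intro ext)
    fix x y
    have "{enat k | k. \<exists>l. 1 \<le> l \<and> l \<le> om x \<and> S x l k = y}
        = {enat k | k. \<exists>l. 1 \<le> l \<and> l \<le> om' x \<and> S' x l k = y}"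
      using assms(1)[of x] assms(2)[of _ x] by (intro Collect_cong ex_cong1 conj_cong) auto
    then show "tau om S x y = tau om' S' x y" unfolding tau_def by simp
  qed
  then show ?thesis unfolding fpt_def fun_eq_iff by simp
qed

lemma fpt_translate:
  "fpt (\<lambda>x. om (x + a)) (\<lambda>x l k. S (x + a) l k - a) x y = fpt om S (x + a) (y + a)"
proof -
  have tau: "tau (\<lambda>x. om (x + a)) (\<lambda>x l k. S (x + a) l k - a) u v = tau om S (u + a) (v + a)" for u v
    unfolding tau_def diff_eq_eq ..
  show ?thesis
  proof (rule antisym)
    show "fpt (\<lambda>x. om (x + a)) (\<lambda>x l k. S (x + a) l k - a) x y \<le> fpt om S (x + a) (y + a)"
    proof (rule enat_le_by_finite)
      fix k assume "fpt om S (x + a) (y + a) \<le> enat k"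
      then obtain m p where "1 \<le> m" "p 0 = x + a" "p m = y + a"
        "(\<Sum>i<m. tau om S (p i) (p (Suc i))) \<le> enat k"
        unfolding fpt_le_iff by blast
      then show "fpt (\<lambda>x. om (x + a)) (\<lambda>x l k. S (x + a) l k - a) x y \<le> enat k"
        unfolding fpt_le_iff tau by (intro exI[of _ m] exI[of _ "\<lambda>i. p i - a"]) auto
    qed
    show "fpt om S (x + a) (y + a) \<le> fpt (\<lambda>x. om (x + a)) (\<lambda>x l k. S (x + a) l k - a) x y"
    proof (rule enat_le_by_finite)
      fix k assume "fpt (\<lambda>x. om (x + a)) (\<lambda>x l k. S (x + a) l k - a) x y \<le> enat k"
      then obtain m p where "1 \<le> m" "p 0 = x" "p m = y"
        "(\<Sum>i<m. tau om S (p i + a) (p (Suc i) + a)) \<le> enat k"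
        unfolding fpt_le_iff tau by blast
      then show "fpt om S (x + a) (y + a) \<le> enat k"
        unfolding fpt_le_iff by (intro exI[of _ m] exI[of _ "\<lambda>i. p i + a"]) auto
    qed
  qed
qed

text \<open>Sites are emptied rather than walks stopped: a walk may still leave \<open>A\<close>,
  but only frogs that start in \<open>A\<close> can serve as relays.\<close>

definition mask :: "(int^'d) set \<Rightarrow> (int^'d \<Rightarrow> nat) \<Rightarrow> int^'d \<Rightarrow> nat" where
  "mask A om x = (if x \<in> A then om x else 0)"

lemma fpt_mask_ge: "fpt om S x y \<le> fpt (mask A om) S x y"
proof (rule enat_le_by_finite)
  fix k assume "fpt (mask A om) S x y \<le> enat k"
  then obtain m p where p: "1 \<le> m" "p 0 = x" "p m = y"
    "(\<Sum>i<m. tau (mask A om) S (p i) (p (Suc i))) \<le> enat k"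
    unfolding fpt_le_iff by blast
  have "tau om S u v \<le> tau (mask A om) S u v" for u v
    by (rule enat_le_by_finite) (auto simp: tau_le_iff mask_def split: if_splits)
  then have "(\<Sum>i<m. tau om S (p i) (p (Suc i))) \<le> enat k"
    using p(4) by (intro order_trans[OF sum_mono p(4)])
  with p show "fpt om S x y \<le> enat k" unfolding fpt_le_iff by blast
qed

text \<open>Walks have speed at most one, so a passage time at most \<open>r\<close> is decided inside a ball of
  radius \<open>r\<close>.\<close>

lemma fpt_mask_le:
  assumes nn: "nearest_neighbour S" and le: "fpt om S x y \<le> enat k" "real k \<le> r"
  shows "fpt (mask {z. norm1 (z - x) \<le> r} om) S x y \<le> enat k"
proof -
  obtain m p where p: "1 \<le> m" "p 0 = x" "p m = y"
    "(\<Sum>i<m. tau om S (p i) (p (Suc i))) \<le> enat k"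
    using le(1) unfolding fpt_le_iff by blast
  have "tau (mask {z. norm1 (z - x) \<le> r} om) S (p i) (p (Suc i)) = tau om S (p i) (p (Suc i))"
    if "i < m" for i
  proof -
    have "(\<Sum>j<i. tau om S (p j) (p (Suc j))) \<le> (\<Sum>j<m. tau om S (p j) (p (Suc j)))"
      using that by (intro sum_mono2) auto
    then have "norm1 (p i - p 0) \<le> real k"
      using norm1_le_path_cost[OF nn, where m = i and om = om and p = p and k = k] p(4) by simp
    then have "norm1 (p i - x) \<le> r" using p(2) le(2) by simp
    then show ?thesis unfolding tau_def mask_def by simp
  qed
  then show ?thesis unfolding fpt_le_iff using p by (intro exI[of _ m] exI[of _ p]) simp
qed

section \<open>Skeleton of a path\<close>

text \<open>The successor of a skeleton point is the vertex right after the last visit to its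
  \<open>K\<close>-ball; taking the last visit instead of the first makes skeleton points pairwise
  \<open>K\<close>-separated.\<close>

lemma path_skeleton:
  fixes p :: "nat \<Rightarrow> int^'d"
  assumes "a \<le> m" "\<And>i. a \<le> i \<Longrightarrow> i < m \<Longrightarrow> norm1 (p (Suc i) - p i) < K" "K > 0"
  obtains js where "js \<noteq> []" "hd js = a" "set js \<subseteq> {a..m}"
    "sorted_wrt (\<lambda>i j. i < j \<and> norm1 (p j - p i) \<ge> K) js"
    "successively (\<lambda>i j. norm1 (p j - p i) < 2 * K) js"
    "norm1 (p m - p (last js)) < K"
  using assms(1,2)
proof (induction "m - a" arbitrary: a thesis rule: less_induct)
  case less
  show thesis
  proof (cases "norm1 (p m - p a) < K")
    case True
    show thesis by (rule less.prems(1)[of "[a]"]) (use True less.prems in auto)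
  next
    case False
    define B where "B = {i\<in>{a..m}. norm1 (p i - p a) < K}"
    define b where "b = Max B"
    have fin: "finite B" and "a \<in> B" using less.prems \<open>K > 0\<close> by (auto simp: B_def)
    then have "b \<in> B" and maxB: "\<And>i. i \<in> B \<Longrightarrow> i \<le> b" unfolding b_def by (auto intro: Max_in)
    have "b \<noteq> m" using \<open>b \<in> B\<close> False by (auto simp: B_def)
    then have b: "a \<le> b" "b < m" "norm1 (p b - p a) < K" using \<open>b \<in> B\<close> by (auto simp: B_def)
    have far: "norm1 (p j - p a) \<ge> K" if "b < j" "j \<le> m" for j
      using maxB[of j] that b by (force simp: B_def)
    obtain js where js: "js \<noteq> []" "hd js = Suc b" "set js \<subseteq> {Suc b..m}"
      "sorted_wrt (\<lambda>i j. i < j \<and> norm1 (p j - p i) \<ge> K) js"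
      "successively (\<lambda>i j. norm1 (p j - p i) < 2 * K) js"
      "norm1 (p m - p (last js)) < K"
    proof (rule less.hyps[of "Suc b"])
      show "m - Suc b < m - a" "Suc b \<le> m" using b by auto
      show "norm1 (p (Suc i) - p i) < K" if "Suc b \<le> i" "i < m" for i
        using less.prems(3)[of i] that b by simp
    qed blast
    have "norm1 (p (Suc b) - p a) < 2 * K"
      using norm1_triangle_diff[of "p (Suc b)" "p a" "p b"] less.prems(3)[of b] b by linarith
    then show thesis
      using js b far by (intro less.prems(1)[of "a # js"]) (auto simp: successively_Cons)
  qed
qed

section \<open>Coarse graining\<close>

definition blk :: "nat \<Rightarrow> int^'d \<Rightarrow> int^'d" where
  "blk s z = (\<chi> i. z $ i div int s)"

text \<open>The candidate starting points attached to a block lie outside of it, at distance comparable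
  to \<open>s\<close>: the time constant says nothing about passage times to nearby points.\<close>

definition cand :: "nat \<Rightarrow> int^'d \<Rightarrow> nat \<Rightarrow> int^'d" where
  "cand s v j = (\<chi> i. int s * v $ i - int s - int j)"

text \<open>In each coordinate the difference is a remainder modulo \<open>s\<close>, plus
  \<open>s\<close>, plus \<open>j\<close>, hence between \<open>s\<close> and \<open>3 * s\<close>.
  This is the origin of the constant \<open>c\<close> in the later estimates.\<close>

lemma cand_dist:
  fixes z :: "int^'d"
  assumes "s > 0" "j < s"
  shows "real s \<le> norm1 (z - cand s (blk s z) j)"
    and "norm1 (z - cand s (blk s z) j) \<le> real CARD('d) * (3 * real s)"
proof -
  have *: "int s \<le> (z - cand s (blk s z) j) $ i \<and> (z - cand s (blk s z) j) $ i \<le> 3 * int s" for i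
  proof -
    have "(z - cand s (blk s z) j) $ i = z $ i mod int s + int s + int j"
      by (simp add: cand_def blk_def minus_mult_div_eq_mod)
    moreover have "0 \<le> z $ i mod int s" "z $ i mod int s < int s" using assms by auto
    ultimately show ?thesis using assms by linarith
  qed
  fix i0 :: 'd
  show "real s \<le> norm1 (z - cand s (blk s z) j)"
    using *[of i0] abs_coord_le_norm1[of "z - cand s (blk s z) j" i0] by linarith
  show "norm1 (z - cand s (blk s z) j) \<le> real CARD('d) * (3 * real s)"
  proof (rule norm1_le_card)
    fix i show "real_of_int \<bar>(z - cand s (blk s z) j) $ i\<bar> \<le> 3 * real s"
      using *[of i] by linarith
  qed
qed

lemma blk_diff_le:
  assumes "s > 0" "norm1 (z' - z) < 2 * real (H * s)"
  shows "\<bar>blk s z' $ i - blk s z $ i\<bar> \<le> 2 * int H"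
proof -
  have "real_of_int \<bar>(z' - z) $ i\<bar> < 2 * real (H * s)"
    using abs_coord_le_norm1[of "z' - z" i] assms(2) by linarith
  then have "real_of_int \<bar>z' $ i - z $ i\<bar> < real_of_int (2 * int H * int s)" by simp
  then have "\<bar>z' $ i - z $ i\<bar> \<le> 2 * int H * int s" by linarith
  then have le: "z' $ i \<le> z $ i + 2 * int H * int s" "z $ i \<le> z' $ i + 2 * int H * int s"
    by linarith+
  have "z' $ i div int s \<le> z $ i div int s + 2 * int H"
    using zdiv_mono1[OF le(1), of "int s"] assms(1) by simp
  moreover have "z $ i div int s \<le> z' $ i div int s + 2 * int H"
    using zdiv_mono1[OF le(2), of "int s"] assms(1) by simp
  ultimately show ?thesis by (simp add: blk_def)
qed

text \<open>Used in contrapositive form: skeleton points at distance at least \<open>K\<close>,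
  which exceeds \<open>CARD('d) * s\<close>, lie in different blocks.\<close>

lemma blk_eq_dist:
  fixes z :: "int^'d"
  assumes "s > 0" "blk s z' = blk s z"
  shows "norm1 (z' - z) \<le> real CARD('d) * real s"
proof (rule norm1_le_card)
  fix i
  have "z' $ i div int s = z $ i div int s"
    using assms(2) by (simp add: blk_def vec_eq_iff)
  then have "z' $ i - z $ i = z' $ i mod int s - z $ i mod int s"
    by (simp add: minus_mult_div_eq_mod[symmetric])
  moreover have "0 \<le> z $ i mod int s" "z $ i mod int s < int s"
    "0 \<le> z' $ i mod int s" "z' $ i mod int s < int s" using assms(1) by auto
  ultimately have "\<bar>z' $ i - z $ i\<bar> \<le> int s" by linarith
  then show "real_of_int \<bar>(z' - z) $ i\<bar> \<le> real s" by simp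
qed

text \<open>Masking \<open>om\<close> makes the event depend on finitely many sites only.\<close>

definition good :: "(int^'d \<Rightarrow> real) \<Rightarrow> real \<Rightarrow> nat \<Rightarrow> real \<Rightarrow> real \<Rightarrow>
    (int^'d \<Rightarrow> nat) \<Rightarrow> (int^'d \<Rightarrow> nat \<Rightarrow> nat \<Rightarrow> int^'d) \<Rightarrow> int^'d \<Rightarrow> bool" where
  "good m \<delta> s L R om S w \<longleftrightarrow>
     (\<forall>y. real s \<le> norm1 (y - w) \<and> norm1 (y - w) \<le> L \<longrightarrow>
       (\<exists>k. fpt (mask {z. norm1 (z - w) \<le> R} om) S w y = enat k \<and>
            \<bar>real k - m (y - w)\<bar> \<le> \<delta> * norm1 (y - w)))"

text \<open>A single candidate is empty with a probability that does not shrink with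
  \<open>s\<close>. Requiring all \<open>N\<close> candidates to fail makes this contribution as
  small as desired.\<close>

definition bad_block :: "(int^'d \<Rightarrow> real) \<Rightarrow> real \<Rightarrow> nat \<Rightarrow> real \<Rightarrow> real \<Rightarrow> nat \<Rightarrow>
    (int^'d \<Rightarrow> nat) \<Rightarrow> (int^'d \<Rightarrow> nat \<Rightarrow> nat \<Rightarrow> int^'d) \<Rightarrow> int^'d \<Rightarrow> bool" where
  "bad_block m \<delta> s L R N om S v \<longleftrightarrow> (\<forall>j<N. \<not> good m \<delta> s L R om S (cand s v j))"

section \<open>Deterministic consequences of a fast passage\<close>

locale discrete_norm =
  fixes m :: "int^'d \<Rightarrow> real" and C :: real
  assumes m_add: "m (x + y) \<le> m x + m y"
    and m_minus: "m (- x) = m x"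
    and m_le: "m x \<le> C * norm1 x"
    and C_nonneg: "0 \<le> C"
begin

lemma m_triangle: "m (x - z) \<le> m (x - y) + m (y - z)"
  using m_add[of "x - y" "y - z"] by simp

lemma m_commute: "m (x - y) = m (y - x)"
  using m_minus[of "x - y"] by simp

text \<open>The triangle inequality T(w,y) \<le> T(w,z) + T(z,y), started at the good site
  \<open>w\<close>, is read as a lower bound for its last term. The loss \<open>2 * C * c\<close>
  has two equal sources: the time from \<open>w\<close> to \<open>z\<close>, and the replacement of
  \<open>y - w\<close> by \<open>y - z\<close> inside \<open>m\<close>.\<close>

lemma good_lower_bound:
  assumes nn: "nearest_neighbour S"
    and good: "good m \<delta> s L R om S w"
    and z: "real s \<le> norm1 (z - w)" "norm1 (z - w) \<le> c"
    and y: "c + real s \<le> norm1 (y - z)" "norm1 (y - z) \<le> b"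
    and L: "b + c \<le> L" and R: "C * L \<le> R" and "0 \<le> \<delta>"
    and k: "fpt om S z y = enat k"
  shows "m (y - z) - (2 * C * c + \<delta> * (b + 2 * c)) \<le> real k"
proof -
  have yw: "norm1 (y - w) \<le> b + c" "real s \<le> norm1 (y - w)"
    using norm1_triangle_diff[of y w z] norm1_triangle_diff[of y z w] norm1_minus_commute[of z w] y z
    by linarith+
  have "norm1 (z - w) \<le> L" using z y L by (smt (verit) norm1_nonneg)
  then obtain a where a: "fpt (mask {z. norm1 (z - w) \<le> R} om) S w z = enat a"
      "\<bar>real a - m (z - w)\<bar> \<le> \<delta> * norm1 (z - w)"
    using good z unfolding good_def by blast
  obtain a' where a': "fpt (mask {z. norm1 (z - w) \<le> R} om) S w y = enat a'"
      "\<bar>real a' - m (y - w)\<bar> \<le> \<delta> * norm1 (y - w)"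
    using good yw L unfolding good_def by (meson order_trans)
  have "fpt om S w z \<le> enat a" using fpt_mask_ge[of om S w z] a(1) by metis
  then have "fpt om S w y \<le> enat (a + k)"
    using fpt_triangle[of om S w y z] k
    by (metis (no_types, lifting) add_right_mono order_trans plus_enat_simps(1))
  then obtain q where q: "fpt om S w y = enat q" "q \<le> a + k"
    by (cases "fpt om S w y") auto
  \<comment> \<open>The unmasked time \<open>q\<close> might undercut the masked one. Up to
    \<open>R\<close> the mask has no effect; beyond \<open>R\<close> the bound holds anyway, since
    \<open>m (y - w) \<le> C * L \<le> R\<close>.\<close>
  have "m (y - w) - \<delta> * norm1 (y - w) \<le> real q"
  proof (cases "real q \<le> R")
    case True
    then have "fpt (mask {z. norm1 (z - w) \<le> R} om) S w y \<le> enat q"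
      using fpt_mask_le[OF nn, of om w y q R] q by simp
    then show ?thesis using a' by simp
  next
    case False
    have "m (y - w) \<le> C * norm1 (y - w)" by (rule m_le)
    also have "\<dots> \<le> C * L" using yw L C_nonneg by (intro mult_left_mono) auto
    finally have "m (y - w) \<le> real q" using False R by simp
    moreover have "0 \<le> \<delta> * norm1 (y - w)" using \<open>0 \<le> \<delta>\<close> by simp
    ultimately show ?thesis by linarith
  qed
  moreover have "m (y - z) \<le> m (y - w) + m (z - w)"
    using m_triangle[of y z w] m_commute[of z w] by simp
  moreover have "m (z - w) \<le> C * c"
    using m_le[of "z - w"] z(2) C_nonneg by (meson mult_left_mono order_trans)
  moreover have "\<delta> * norm1 (y - w) \<le> \<delta> * (b + c)" "\<delta> * norm1 (z - w) \<le> \<delta> * c"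
    using yw z \<open>0 \<le> \<delta>\<close> by (auto intro: mult_left_mono)
  ultimately have "m (y - z) \<le> real k + 2 * (C * c) + (\<delta> * (b + c) + \<delta> * c)"
    using a(2) q(2) by linarith
  then show ?thesis by (simp add: algebra_simps)
qed

text \<open>The \<open>m\<close>-lengths of the skeleton steps are compared with the time they take
  and summed. Steps out of good blocks lose only the error term; steps out of bad blocks are charged
  in full to these blocks. The uncontrolled piece from the last skeleton point to \<open>x\<close>
  costs the final \<open>C * K\<close>.\<close>

theorem fast_passage_bad_blocks:
  fixes H s N t :: nat and L R \<delta> :: real and x :: "int^'d"
  defines "K \<equiv> real (H * s)" and "c \<equiv> real CARD('d) * (3 * real s)"
  assumes nn: "nearest_neighbour S"
    and s: "0 < s" "N \<le> s" and H: "3 * CARD('d) + 1 \<le> H"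
    and L: "2 * K + c \<le> L" and R: "C * L \<le> R" and \<delta>: "0 \<le> \<delta>"
    and short: "\<And>y l k. norm1 y \<le> real t \<Longrightarrow> 1 \<le> l \<Longrightarrow> l \<le> om y \<Longrightarrow> k \<le> t \<Longrightarrow>
                  norm1 (S y l k - y) < K"
    and fast: "fpt om S 0 x \<le> enat t"
  obtains vs where "vs \<noteq> []" "hd vs = 0" "distinct vs"
    "successively (\<lambda>u v. \<forall>i. \<bar>v $ i - u $ i\<bar> \<le> 2 * int H) vs"
    "real (length vs - 1) * K \<le> real t"
    "m x \<le> real t + real (length vs - 1) * (2 * C * c + \<delta> * (2 * K + 2 * c))
       + 2 * C * K * real (card {v\<in>set vs. bad_block m \<delta> s L R N om S v}) + C * K"
proof -
  obtain M p where p: "1 \<le> M" "p 0 = 0" "p M = x"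
    "(\<Sum>i<M. tau om S (p i) (p (Suc i))) \<le> enat t"
    using fast unfolding fpt_le_iff by blast
  have d1: "1 \<le> CARD('d)" by (simp add: Suc_leI)
  have "(3 * CARD('d) + 1) * s \<le> H * s" using H by (rule mult_le_mono1)
  then have "real ((3 * CARD('d) + 1) * s) \<le> K" unfolding K_def by (rule of_nat_mono)
  \<comment> \<open>This is the purpose of the lower bound on \<open>H\<close>: the next skeleton
    point is so far away that it also has distance at least \<open>s\<close> from any candidate near
    the current one.\<close>
  then have cK: "c + real s \<le> K" by (simp add: c_def algebra_simps)
  have "real CARD('d) * real s \<le> c" by (simp add: c_def)
  moreover have c0: "0 \<le> c" by (simp add: c_def)
  ultimately have Kpos: "0 < K" and dK: "real CARD('d) * real s < K" using cK s by linarith+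
  have tau_fin: "\<exists>a. tau om S (p i) (p (Suc i)) = enat a" if "i < M" for i
  proof -
    have "tau om S (p i) (p (Suc i)) \<le> (\<Sum>i<M. tau om S (p i) (p (Suc i)))"
      using that by (intro member_le_sum) auto
    then have "tau om S (p i) (p (Suc i)) \<le> enat t" using p(4) by (rule order_trans)
    then show ?thesis by (cases "tau om S (p i) (p (Suc i))") auto
  qed
  define q where "q i = the_enat (tau om S (p i) (p (Suc i)))" for i
  \<comment> \<open>\<open>Q j\<close> is the arrival time of the path at \<open>p j\<close>. Finite
    times can be subtracted, as the telescoping below demands.\<close>
  define Q where "Q j = (\<Sum>i<j. q i)" for j
  have q: "tau om S (p i) (p (Suc i)) = enat (q i)" if "i < M" for i
    using tau_fin[OF that] unfolding q_def by auto
  have sum_q: "(\<Sum>k\<in>A. tau om S (p k) (p (Suc k))) = enat (\<Sum>k\<in>A. q k)" if "A \<subseteq> {..<M}" for A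
    using finite_subset[OF that finite_lessThan] that
    by (induction A rule: finite_induct) (auto simp: q zero_enat_def)
  have QM: "Q M \<le> t" using p(4) sum_q[of "{..<M}"] by (simp add: Q_def)
  have Q_le: "Q i \<le> Q j" if "i \<le> j" for i j
    unfolding Q_def using that by (intro sum_mono2) auto
  have fptQ: "\<exists>k. fpt om S (p i) (p j) = enat k \<and> real k \<le> real (Q j) - real (Q i)"
    if "i < j" "j \<le> M" for i j
  proof -
    have "fpt om S (p i) (p j) \<le> enat (\<Sum>k\<in>{i..<j}. q k)"
    proof -
      have "{i..<j} \<subseteq> {..<M}" using that by auto
      from sum_q[OF this] show ?thesis using fpt_le_path_cost[OF that(1), of om S p] by simp
    qed
    then obtain k where k: "fpt om S (p i) (p j) = enat k" "k \<le> (\<Sum>k\<in>{i..<j}. q k)"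
      by (cases "fpt om S (p i) (p j)") auto
    moreover have "Q j = Q i + (\<Sum>k\<in>{i..<j}. q k)"
      unfolding Q_def using that(1)
      by (subst sum.union_disjoint[symmetric]) (auto intro!: sum.cong)
    ultimately have "k + Q i \<le> Q j" by simp
    then have "real k \<le> real (Q j) - real (Q i)" by linarith
    with k(1) show ?thesis by blast
  qed
  \<comment> \<open>Unit speed and total cost at most \<open>t\<close> keep \<open>p i\<close>
    inside the ball covered by \<open>short\<close>, and the leg itself also lasts at most
    \<open>t\<close>.\<close>
  have jump: "norm1 (p (Suc i) - p i) < K" if "i < M" for i
  proof -
    have "(\<Sum>j<i. tau om S (p j) (p (Suc j))) \<le> enat t"
      using sum_q[of "{..<i}"] that Q_le[of i M] QM by (auto simp: Q_def)
    then have 1: "norm1 (p i) \<le> real t"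
      using norm1_le_path_cost[OF nn, where p = p and m = i] p(2) by fastforce
    have "q i \<le> Q M" unfolding Q_def using that by (intro member_le_sum) auto
    then have "tau om S (p i) (p (Suc i)) \<le> enat t" using q[OF that] QM by simp
    then obtain k l where "k \<le> t" "1 \<le> l" "l \<le> om (p i)" "S (p i) l k = p (Suc i)"
      unfolding tau_le_iff by blast
    then show ?thesis using short[OF 1, of l k] by simp
  qed
  obtain js where js: "js \<noteq> []" "hd js = 0" "set js \<subseteq> {0..M}"
    "sorted_wrt (\<lambda>i j. i < j \<and> norm1 (p j - p i) \<ge> K) js"
    "successively (\<lambda>i j. norm1 (p j - p i) < 2 * K) js"
    "norm1 (p M - p (last js)) < K"
    using path_skeleton[of 0 M p K] jump Kpos by blast
  define bad where "bad = bad_block m \<delta> s L R N om S"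
  define e where "e = 2 * C * c + \<delta> * (2 * K + 2 * c)"
  have e0: "0 \<le> e" using C_nonneg \<delta> Kpos c0 by (simp add: e_def)
  \<comment> \<open>Nothing is known about a bad block, so the whole \<open>m\<close>-length of the
    step, at most \<open>C * (2 * K)\<close>, is charged to it. The second claim is unit speed; it
    bounds the number of steps.\<close>
  have step: "m (p j - p i) \<le> real (Q j) - real (Q i) + e
                + 2 * C * K * (if bad (blk s (p i)) then 1 else 0)"
      "K \<le> real (Q j) - real (Q i)"
    if ij: "i < j" "j \<le> M" "norm1 (p j - p i) < 2 * K" "norm1 (p j - p i) \<ge> K" for i j
  proof -
    obtain k where k: "fpt om S (p i) (p j) = enat k" "real k \<le> real (Q j) - real (Q i)"
      using fptQ[OF ij(1,2)] by blast
    have nk: "norm1 (p j - p i) \<le> real k" using norm1_le_fpt[OF nn, of om] k(1) by simp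
    then show "K \<le> real (Q j) - real (Q i)" using k ij by linarith
    show "m (p j - p i) \<le> real (Q j) - real (Q i) + e
            + 2 * C * K * (if bad (blk s (p i)) then 1 else 0)"
    proof (cases "bad (blk s (p i))")
      case True
      have "m (p j - p i) \<le> C * norm1 (p j - p i)" by (rule m_le)
      also have "\<dots> \<le> C * (2 * K)" using ij C_nonneg by (intro mult_left_mono) auto
      finally show ?thesis using True k nk norm1_nonneg[of "p j - p i"] e0 by simp
    next
      case False
      then obtain n where n: "n < N" "good m \<delta> s L R om S (cand s (blk s (p i)) n)"
        unfolding bad_def bad_block_def by blast
      have dist: "real s \<le> norm1 (p i - cand s (blk s (p i)) n)"
        "norm1 (p i - cand s (blk s (p i)) n) \<le> c"
        using cand_dist[of s n "p i"] s n by (auto simp: c_def)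
      have "m (p j - p i) - (2 * C * c + \<delta> * (2 * K + 2 * c)) \<le> real k"
        by (rule good_lower_bound[OF nn n(2) dist _ _ L R \<delta> k(1)]) (use ij cK in auto)
      then show ?thesis using False k by (simp add: e_def)
    qed
  qed
  have acc: "m (p (last is) - p (hd is)) \<le> real (Q (last is)) - real (Q (hd is))
        + real (length is - 1) * e
        + 2 * C * K * real (length (filter (\<lambda>i. bad (blk s (p i))) is))
      \<and> real (length is - 1) * K \<le> real (Q (last is)) - real (Q (hd is))"
    if "is \<noteq> []" "set is \<subseteq> {0..M}"
      "sorted_wrt (\<lambda>i j. i < j \<and> norm1 (p j - p i) \<ge> K) is"
      "successively (\<lambda>i j. norm1 (p j - p i) < 2 * K) is" for "is"
    using that
  proof (induction "is" rule: list_nonempty_induct)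
    case (single i)
    have "m 0 \<le> 0" using m_le[of 0] by simp
    then show ?case using C_nonneg Kpos by (auto intro!: add_nonneg_nonneg simp: mult_nonneg_nonneg order_trans)
  next
    case (cons i "is")
    define j where "j = hd is"
    have j: "j \<in> set is" using cons.hyps by (simp add: j_def)
    then have "j \<le> M" using cons.prems by auto
    then have "i < j" "j \<le> M" "norm1 (p j - p i) < 2 * K" "norm1 (p j - p i) \<ge> K"
      using cons.prems j cons.hyps by (auto simp: successively_Cons j_def)
    note st = step[OF this]
    have IH: "m (p (last is) - p j) \<le> real (Q (last is)) - real (Q j)
        + real (length is - 1) * e
        + 2 * C * K * real (length (filter (\<lambda>i. bad (blk s (p i))) is))"
      "real (length is - 1) * K \<le> real (Q (last is)) - real (Q j)"
      using cons.IH cons.prems cons.hyps by (auto simp: successively_Cons j_def)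
    have len: "real (length (i # is) - 1) = real (length is - 1) + 1"
      using cons.hyps by (cases "is") auto
    have flt: "real (length (filter (\<lambda>i. bad (blk s (p i))) (i # is)))
        = real (length (filter (\<lambda>i. bad (blk s (p i))) is)) + (if bad (blk s (p i)) then 1 else 0)"
      by simp
    have "m (p (last is) - p i) \<le> m (p (last is) - p j) + m (p j - p i)" by (rule m_triangle)
    then have "m (p (last is) - p i) \<le> real (Q (last is)) - real (Q i)
        + (real (length is - 1) * e + e)
        + (2 * C * K * real (length (filter (\<lambda>i. bad (blk s (p i))) is))
           + 2 * C * K * (if bad (blk s (p i)) then 1 else 0))"
      using st(1) IH(1) by linarith
    moreover have "real (length is - 1) * K + K \<le> real (Q (last is)) - real (Q i)"
      using st(2) IH(2) by linarith
    ultimately show ?case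
      unfolding len flt using cons.hyps by (simp add: distrib_left distrib_right)
  qed
  define vs where "vs = map (\<lambda>i. blk s (p i)) js"
  \<comment> \<open>All pairs of skeleton points are separated, not only neighbours. Hence a block
    is never revisited, and counting bad steps is the same as counting bad blocks.\<close>
  have inj: "distinct vs"
  proof -
    have "sorted_wrt (\<noteq>) vs"
      unfolding vs_def sorted_wrt_map
    proof (rule sorted_wrt_mono_rel[OF _ js(4)])
      fix i j assume "i < j \<and> norm1 (p j - p i) \<ge> K"
      then show "blk s (p i) \<noteq> blk s (p j)"
        using blk_eq_dist[of s "p j" "p i"] s(1) dK by force
    qed
    then show ?thesis by (simp add: distinct_conv_nth sorted_wrt_iff_nth_less) (metis nat_neq_iff)
  qed
  have card_bad: "length (filter (\<lambda>i. bad (blk s (p i))) js) = card {v\<in>set vs. bad v}"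
  proof -
    have "length (filter (\<lambda>i. bad (blk s (p i))) js) = length (filter bad vs)"
      by (simp add: vs_def filter_map comp_def)
    also have "\<dots> = card (set (filter bad vs))"
      by (rule distinct_card[symmetric, OF distinct_filter[OF inj]])
    finally show ?thesis by simp
  qed
  note A = acc[OF js(1,3,4,5)]
  have "last js \<le> M" using js(1,3) by (meson atLeastAtMost_iff last_in_set subsetD)
  then have "real (Q (last js)) - real (Q (hd js)) \<le> real t"
    using Q_le[of "last js" M] QM by linarith
  note A' = A this
  have "m x \<le> m (x - p (last js)) + m (p (last js) - p (hd js))"
    using m_add[of "x - p (last js)" "p (last js)"] js(2) p(2) by simp
  moreover have "m (x - p (last js)) \<le> C * K"
    using m_le[of "x - p (last js)"] js(6) p(3) C_nonneg by (smt (verit) mult_left_mono)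
  ultimately have fin: "m x \<le> real t + real (length vs - 1) * e
       + 2 * C * K * real (card {v\<in>set vs. bad v}) + C * K"
    using A' card_bad by (simp add: vs_def)
  show thesis
  proof (rule that[of vs])
    show "vs \<noteq> []" using js by (simp add: vs_def)
    show "hd vs = 0" using js p(2) by (simp add: vs_def hd_map blk_def vec_eq_iff)
    show "distinct vs" by (rule inj)
    show "successively (\<lambda>u v. \<forall>i. \<bar>v $ i - u $ i\<bar> \<le> 2 * int H) vs"
      unfolding vs_def successively_map
      by (rule successively_mono[OF js(5)]) (use blk_diff_le[OF s(1)] in \<open>auto simp: K_def\<close>)
    show "real (length vs - 1) * K \<le> real t" using A' by (simp add: vs_def)
  qed (use fin in \<open>simp add: e_def bad_def\<close>)
qed

end

section \<open>Chains of neighbouring blocks\<close>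

definition block_chains :: "nat \<Rightarrow> nat \<Rightarrow> int^'d \<Rightarrow> (int^'d) list set" where
  "block_chains q k v = {vs. length vs = Suc k \<and> hd vs = v \<and>
     successively (\<lambda>u v. \<forall>i. \<bar>v $ i - u $ i\<bar> \<le> int q) vs}"

lemma card_block_chains_le:
  fixes v :: "int^'d"
  shows "finite (block_chains q k v) \<and> card (block_chains q k v) \<le> ((2 * q + 1) ^ CARD('d)) ^ k"
proof (induction k arbitrary: v)
  case 0
  have "block_chains q 0 v = {[v]}"
    by (auto simp: block_chains_def length_Suc_conv)
  then show ?case by simp
next
  case (Suc k)
  define B where "B = {u :: int^'d. \<forall>i. u $ i \<in> {v $ i - int q..v $ i + int q}}"
  have B: "finite B" "card B = (2 * q + 1) ^ CARD('d)"
    unfolding B_def by (subst card_vec_box | simp add: nat_add_distrib nat_mult_distrib algebra_simps)+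
  have eq: "block_chains q (Suc k) v = (\<Union>u\<in>B. (#) v ` block_chains q k u)"
  proof (intro equalityI subsetI)
    fix vs assume vs: "vs \<in> block_chains q (Suc k) v"
    then obtain ws where ws: "vs = v # ws" "length ws = Suc k"
      by (cases vs) (auto simp: block_chains_def)
    then have "ws \<noteq> []" by auto
    then have "ws \<in> block_chains q k (hd ws)" "hd ws \<in> B"
      using vs ws by (auto simp: block_chains_def successively_Cons B_def abs_le_iff algebra_simps)
    then show "vs \<in> (\<Union>u\<in>B. (#) v ` block_chains q k u)" using ws by blast
  next
    fix vs assume "vs \<in> (\<Union>u\<in>B. (#) v ` block_chains q k u)"
    then show "vs \<in> block_chains q (Suc k) v"
      by (auto simp: block_chains_def successively_Cons B_def abs_le_iff algebra_simps)
  qed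
  have "card (block_chains q (Suc k) v) \<le> (\<Sum>u\<in>B. card ((#) v ` block_chains q k u))"
    unfolding eq using B by (intro card_UN_le) auto
  also have "\<dots> \<le> (\<Sum>u\<in>B. ((2 * q + 1) ^ CARD('d)) ^ k)"
    using Suc.IH by (intro sum_mono order_trans[OF card_image_le]) auto
  also have "\<dots> = ((2 * q + 1) ^ CARD('d)) ^ Suc k" using B by simp
  finally have "card (block_chains q (Suc k) v) \<le> ((2 * q + 1) ^ CARD('d)) ^ Suc k" .
  moreover have "finite (block_chains q (Suc k) v)"
    unfolding eq using B(1) Suc.IH by auto
  ultimately show ?case by blast
qed

text \<open>Pigeonhole over the \<open>D ^ CARD('d)\<close> residue classes modulo \<open>D\<close>:
  two distinct points of one class differ in some coordinate by a nonzero multiple of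
  \<open>D\<close>.\<close>

lemma separated_subset:
  fixes W :: "(int^'d) set"
  assumes "finite W" "0 < D" "D ^ CARD('d) * b \<le> card W"
  obtains W' where "W' \<subseteq> W" "card W' = b"
    "\<And>u v. u \<in> W' \<Longrightarrow> v \<in> W' \<Longrightarrow> u \<noteq> v \<Longrightarrow> \<exists>i. int D \<le> \<bar>u $ i - v $ i\<bar>"
proof -
  define res :: "int^'d \<Rightarrow> int^'d" where "res v = (\<chi> i. v $ i mod int D)" for v
  define B where "B = {u :: int^'d. \<forall>i. u $ i \<in> {0..<int D}}"
  have B: "finite B" "card B = D ^ CARD('d)"
    unfolding B_def by (subst card_vec_box | simp)+
  have "\<exists>c\<in>B. b \<le> card {v\<in>W. res v = c}"
  proof (rule ccontr)
    assume "\<not> ?thesis"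
    then have small: "card {v\<in>W. res v = c} < b" if "c \<in> B" for c using that by auto
    have "card W = (\<Sum>c\<in>B. card {v\<in>W. res v = c})"
    proof -
      have "W = (\<Union>c\<in>B. {v\<in>W. res v = c})" using assms(2) by (auto simp: B_def res_def)
      then have "card W = card (\<Union>c\<in>B. {v\<in>W. res v = c})" by simp
      also have "\<dots> = (\<Sum>c\<in>B. card {v\<in>W. res v = c})"
        using B(1) assms(1) by (intro card_UN_disjoint) auto
      finally show ?thesis .
    qed
    also have "\<dots> < (\<Sum>c\<in>B. b)"
    proof (rule sum_strict_mono[OF B(1)])
      show "B \<noteq> {}" using B assms(2) by auto
    qed (use small in auto)
    finally show False using assms(3) B by simp
  qed
  then obtain c where c: "b \<le> card {v\<in>W. res v = c}" by blast
  then obtain W' where W': "W' \<subseteq> {v\<in>W. res v = c}" "card W' = b"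
    using obtain_subset_with_card_n[OF c] by blast
  show thesis
  proof (rule that[of W'])
    fix u v assume uv: "u \<in> W'" "v \<in> W'" "u \<noteq> v"
    then obtain i where i: "u $ i \<noteq> v $ i" by (auto simp: vec_eq_iff)
    have "res u = res v" using uv W' by blast
    then have "u $ i mod int D = v $ i mod int D" by (simp add: res_def vec_eq_iff)
    then have "int D dvd (u $ i - v $ i)" by (simp add: mod_eq_dvd_iff)
    then show "\<exists>i. int D \<le> \<bar>u $ i - v $ i\<bar>"
      using i dvd_imp_le_int[of "u $ i - v $ i" "int D"] by auto
  qed (use W' in auto)
qed

section \<open>Configurations and measurability\<close>

text \<open>Frog numbers and increments share one index type, so a single independent family carries
  all the randomness. Positions are recovered from the increments by summation.\<close>

type_synonym 'd config = "(int^'d) + ((int^'d) \<times> nat \<times> nat) \<Rightarrow> nat + (int^'d)"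

definition om_of :: "'d config \<Rightarrow> int^'d \<Rightarrow> nat" where
  "om_of r x = projl (r (Inl x))"

definition walk_of :: "'d config \<Rightarrow> int^'d \<Rightarrow> nat \<Rightarrow> nat \<Rightarrow> int^'d" where
  "walk_of r x l k = x + (\<Sum>j<k. projr (r (Inr (x, l, j))))"

definition site_idx :: "(int^'d) set \<Rightarrow> ((int^'d) + ((int^'d) \<times> nat \<times> nat)) set" where
  "site_idx A = Inl ` A \<union> Inr ` {(x, l, k). x \<in> A \<and> 1 \<le> l}"

text \<open>The default \<open>Inl 0\<close> empties the sites outside \<open>A\<close>. At walk
  indices it is a junk value, but such walks start at an emptied site or have label 0, so passage
  times never read it. The result is a total configuration determined by the coordinates in
  \<open>site_idx A\<close>.\<close>

definition fill :: "(int^'d) set \<Rightarrow> 'd config \<Rightarrow> 'd config" where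
  "fill A r i = (if i \<in> site_idx A then r i else Inl 0)"

definition shift :: "int^'d \<Rightarrow> 'd config \<Rightarrow> 'd config" where
  "shift a r i = r (case i of Inl x \<Rightarrow> Inl (x + a) | Inr (x, l, k) \<Rightarrow> Inr (x + a, l, k))"

abbreviation config_space :: "(int^'d) set \<Rightarrow> 'd config measure" where
  "config_space A \<equiv> PiM (site_idx A) (\<lambda>_. count_space UNIV)"

abbreviation config_fpt :: "'d config \<Rightarrow> int^'d \<Rightarrow> int^'d \<Rightarrow> enat" where
  "config_fpt r \<equiv> fpt (om_of r) (walk_of r)"

lemma om_of_shift: "om_of (shift a r) x = om_of r (x + a)"
  by (simp add: om_of_def shift_def)

lemma walk_of_shift: "walk_of (shift a r) x l k = walk_of r (x + a) l k - a"
  by (simp add: walk_of_def shift_def)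

lemma config_fpt_shift: "config_fpt (shift a r) x y = config_fpt r (x + a) (y + a)"
  using fpt_translate[of "om_of r" a "walk_of r" x y]
  by (simp add: om_of_shift[abs_def] walk_of_shift[abs_def])

lemma mask_fill:
  assumes "B \<subseteq> A"
  shows "fpt (mask B (om_of (fill A r))) (walk_of (fill A r)) = fpt (mask B (om_of r)) (walk_of r)"
proof (rule fpt_cong)
  show "mask B (om_of (fill A r)) x = mask B (om_of r) x" for x
    using assms by (auto simp: mask_def om_of_def fill_def site_idx_def)
  fix x :: "int^'a" and l k :: nat
  assume "1 \<le> l" "l \<le> mask B (om_of (fill A r)) x"
  then have "x \<in> A" using assms by (auto simp: mask_def split: if_splits)
  then show "walk_of (fill A r) x l k = walk_of r x l k"
    using \<open>1 \<le> l\<close> by (auto simp: walk_of_def fill_def site_idx_def intro!: sum.cong)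
qed

section \<open>Measurability of passage times and block events\<close>

lemma measurable_binop_countable:
  fixes f :: "'w \<Rightarrow> 'b::countable"
  assumes "f \<in> measurable N (count_space UNIV)" "g \<in> measurable N (count_space UNIV)"
  shows "(\<lambda>w. h (f w) (g w)) \<in> measurable N (count_space UNIV)"
proof (rule measurable_compose_countable[OF _ assms(1), of "\<lambda>a w. h a (g w)"])
  show "(\<lambda>w. h a (g w)) \<in> measurable N (count_space UNIV)" for a
    using measurable_compose[OF assms(2), of "h a"] by simp
qed

lemma measurable_sum_countable:
  fixes f :: "'i \<Rightarrow> 'w \<Rightarrow> 'b::{countable, comm_monoid_add}"
  assumes "\<And>i. i \<in> A \<Longrightarrow> f i \<in> measurable N (count_space UNIV)"
  shows "(\<lambda>w. \<Sum>i\<in>A. f i w) \<in> measurable N (count_space UNIV)"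
  using assms
proof (induction A rule: infinite_finite_induct)
  case (insert a A)
  then show ?case by (simp add: measurable_binop_countable[where h = "(+)"])
qed auto

lemma measurable_enat_le:
  fixes f :: "'w \<Rightarrow> enat"
  assumes "\<And>k. Measurable.pred N (\<lambda>w. f w \<le> enat k)"
  shows "f \<in> measurable N (count_space UNIV)"
proof -
  have fin: "Measurable.pred N (\<lambda>w. f w = enat k)" for k
  proof -
    have "(\<lambda>w. f w = enat k) = (\<lambda>w. f w \<le> enat k \<and> \<not> (\<exists>j\<in>{..<k}. f w \<le> enat j))"
    proof (intro ext)
      fix w show "(f w = enat k) \<longleftrightarrow> (f w \<le> enat k \<and> \<not> (\<exists>j\<in>{..<k}. f w \<le> enat j))"
      proof (cases "f w")
        case (enat n)
        then show ?thesis by (auto simp: not_less_eq)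
      qed auto
    qed
    then show ?thesis using assms by simp
  qed
  have "Measurable.pred N (\<lambda>w. f w = a)" for a
  proof (cases a)
    case infinity
    have eq: "(\<lambda>w. f w = \<infinity>) = (\<lambda>w. \<not> (\<exists>k. f w = enat k))"
      by (intro ext) simp
    have "Measurable.pred N (\<lambda>w. \<not> (\<exists>k. f w = enat k))" using fin by measurable
    then show ?thesis by (simp only: eq infinity)
  qed (use fin in simp)
  then have "{w \<in> space N. f w = a} \<in> sets N" for a
    unfolding pred_def .
  moreover have "f -` {a} \<inter> space N = {w \<in> space N. f w = a}" for a by auto
  ultimately show ?thesis
    by (subst measurable_count_space_eq2_countable) auto
qed

lemma measurable_tau:
  fixes om :: "'w \<Rightarrow> int^'d \<Rightarrow> nat"
  assumes om: "\<And>x. (\<lambda>w. om w x) \<in> measurable N (count_space UNIV)"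
    and S: "\<And>x l k. (\<lambda>w. S w x l k) \<in> measurable N (count_space UNIV)"
  shows "(\<lambda>w. tau (om w) (S w) x y) \<in> measurable N (count_space UNIV)"
proof (rule measurable_enat_le)
  fix k
  have 1: "Measurable.pred N (\<lambda>w. l \<le> om w x)" for l
    by (rule measurable_compose[OF om, of "\<lambda>n. l \<le> n"]) simp
  have 2: "Measurable.pred N (\<lambda>w. S w x l j = y)" for l j
    by (rule measurable_compose[OF S, of "\<lambda>n. n = y"]) simp
  show "Measurable.pred N (\<lambda>w. tau (om w) (S w) x y \<le> enat k)"
    unfolding tau_le_iff using 1 2 by measurable
qed

text \<open>Paths indexed by all natural numbers form an uncountable set. Finite lists of lattice
  points are countable, which turns the existential into a countable union of events.\<close>

lemma fpt_le_iff_list: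
  "fpt om S x y \<le> enat k \<longleftrightarrow> (\<exists>xs. 2 \<le> length xs \<and> xs ! 0 = x \<and> xs ! (length xs - 1) = y \<and>
     (\<Sum>i<length xs - 1. tau om S (xs ! i) (xs ! Suc i)) \<le> enat k)"
proof
  assume "fpt om S x y \<le> enat k"
  then obtain m p where p: "1 \<le> m" "p 0 = x" "p m = y"
    "(\<Sum>i<m. tau om S (p i) (p (Suc i))) \<le> enat k"
    unfolding fpt_le_iff by blast
  have "(\<Sum>i<m. tau om S (map p [0..<Suc m] ! i) (map p [0..<Suc m] ! Suc i))
      = (\<Sum>i<m. tau om S (p i) (p (Suc i)))"
    by (intro sum.cong) (auto simp del: upt_Suc)
  with p show "\<exists>xs. 2 \<le> length xs \<and> xs ! 0 = x \<and> xs ! (length xs - 1) = y \<and>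
     (\<Sum>i<length xs - 1. tau om S (xs ! i) (xs ! Suc i)) \<le> enat k"
    by (intro exI[of _ "map p [0..<Suc m]"]) (auto simp del: upt_Suc)
next
  assume "\<exists>xs. 2 \<le> length xs \<and> xs ! 0 = x \<and> xs ! (length xs - 1) = y \<and>
     (\<Sum>i<length xs - 1. tau om S (xs ! i) (xs ! Suc i)) \<le> enat k"
  then obtain xs where "2 \<le> length xs" "xs ! 0 = x" "xs ! (length xs - 1) = y"
     "(\<Sum>i<length xs - 1. tau om S (xs ! i) (xs ! Suc i)) \<le> enat k" by blast
  then show "fpt om S x y \<le> enat k" unfolding fpt_le_iff
    by (intro exI[of _ "length xs - 1"] exI[of _ "(!) xs"]) auto
qed

lemma measurable_fpt:
  fixes om :: "'w \<Rightarrow> int^'d \<Rightarrow> nat"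
  assumes om: "\<And>x. (\<lambda>w. om w x) \<in> measurable N (count_space UNIV)"
    and S: "\<And>x l k. (\<lambda>w. S w x l k) \<in> measurable N (count_space UNIV)"
  shows "(\<lambda>w. fpt (om w) (S w) x y) \<in> measurable N (count_space UNIV)"
proof (rule measurable_enat_le)
  fix k
  have "Measurable.pred N
      (\<lambda>w. (\<Sum>i<length xs - 1. tau (om w) (S w) (xs ! i) (xs ! Suc i)) \<le> enat k)" for xs
    by (rule measurable_compose[OF measurable_sum_countable, of _ _ _ "\<lambda>n. n \<le> enat k"])
      (auto intro: measurable_tau om S)
  then show "Measurable.pred N (\<lambda>w. fpt (om w) (S w) x y \<le> enat k)"
    unfolding fpt_le_iff_list by measurable
qed

context
  fixes N :: "'w measure" and Y :: "'w \<Rightarrow> 'd::finite config"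
  assumes Y: "\<And>i. (\<lambda>w. Y w i) \<in> measurable N (count_space UNIV)"
begin

lemma measurable_om_of: "(\<lambda>w. om_of (Y w) x) \<in> measurable N (count_space UNIV)"
  unfolding om_of_def by (rule measurable_compose[OF Y]) simp

lemma measurable_walk_of: "(\<lambda>w. walk_of (Y w) x l k) \<in> measurable N (count_space UNIV)"
proof -
  have "(\<lambda>w. \<Sum>j<k. projr (Y w (Inr (x, l, j)))) \<in> measurable N (count_space UNIV)"
    by (intro measurable_sum_countable measurable_compose[OF Y]) simp
  then show ?thesis unfolding walk_of_def by (rule measurable_compose) simp
qed

lemma measurable_config_fpt: "(\<lambda>w. config_fpt (Y w) x y) \<in> measurable N (count_space UNIV)"
  by (intro measurable_fpt measurable_om_of measurable_walk_of)

lemma measurable_mask_fpt: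
  "(\<lambda>w. fpt (mask A (om_of (Y w))) (walk_of (Y w)) x y) \<in> measurable N (count_space UNIV)"
proof (intro measurable_fpt measurable_walk_of)
  show "(\<lambda>w. mask A (om_of (Y w)) x) \<in> measurable N (count_space UNIV)" for x
    by (cases "x \<in> A") (auto simp: mask_def measurable_om_of)
qed

lemma pred_good: "Measurable.pred N (\<lambda>w. good m \<delta> s L R (om_of (Y w)) (walk_of (Y w)) v)"
proof -
  have "Measurable.pred N (\<lambda>w. Q (fpt (mask A (om_of (Y w))) (walk_of (Y w)) x y))" for Q A x y
    by (rule measurable_compose[OF measurable_mask_fpt]) simp
  then show ?thesis unfolding good_def by measurable
qed

lemma pred_bad_block:
  "Measurable.pred N (\<lambda>w. bad_block m \<delta> s L R n (om_of (Y w)) (walk_of (Y w)) v)"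
  unfolding bad_block_def using pred_good by measurable

end

section \<open>The frog model\<close>

lemma measurable_fill:
  assumes "\<And>i. i \<in> site_idx A \<Longrightarrow> (\<lambda>w. Y w i) \<in> measurable N (count_space UNIV)"
  shows "(\<lambda>w. fill A (Y w) i) \<in> measurable N (count_space UNIV)"
  using assms by (cases "i \<in> site_idx A") (auto simp: fill_def)

lemma measurable_fill_config_space:
  "(\<lambda>r. fill A r i) \<in> measurable (config_space A) (count_space UNIV)"
  by (rule measurable_fill) (rule measurable_component_singleton)

text \<open>Serves two relabellings: translating all sites, and indexing the increments of one walk
  by time alone.\<close>

lemma (in prob_space) indep_vars_reindex:
  assumes ind: "indep_vars (\<lambda>_. N) X (f ` I)" and inj: "inj_on f I"
  shows "indep_vars (\<lambda>_. N) (\<lambda>i. X (f i)) I"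
  unfolding indep_vars_def2 indep_sets_def
proof (intro conjI ballI allI impI)
  note ind' = ind[unfolded indep_vars_def2 indep_sets_def]
  fix J A assume J: "J \<subseteq> I" "J \<noteq> {}" "finite J"
    and A: "A \<in> Pi J (\<lambda>i. {X (f i) -` B \<inter> space M | B. B \<in> sets N})"
  define A' where "A' j = A (the_inv_into J f j)" for j
  have injJ: "inj_on f J" using inj J(1) by (rule inj_on_subset)
  then have A': "A' (f j) = A j" if "j \<in> J" for j using that by (simp add: A'_def the_inv_into_f_f)
  have "prob (\<Inter>j\<in>f ` J. A' j) = (\<Prod>j\<in>f ` J. prob (A' j))"
  proof -
    have "f ` J \<subseteq> f ` I" "f ` J \<noteq> {}" "finite (f ` J)"
      "A' \<in> Pi (f ` J) (\<lambda>i. {X i -` B \<inter> space M | B. B \<in> sets N})"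
      using J A A' by (auto simp: Pi_iff)
    then show ?thesis using ind' by blast
  qed
  then show "prob (\<Inter>j\<in>J. A j) = (\<Prod>j\<in>J. prob (A j))"
    using A' by (simp add: prod.reindex[OF injJ] cong: prod.cong INF_cong)
qed (use ind[unfolded indep_vars_def2 indep_sets_def] in auto)

locale frog_model = prob_space M for M :: "'a measure" +
  fixes \<omega> :: "'a \<Rightarrow> int^'d \<Rightarrow> nat" and S :: "'a \<Rightarrow> int^'d \<Rightarrow> nat \<Rightarrow> nat \<Rightarrow> int^'d"
  assumes indep: "indep_vars (\<lambda>_. count_space UNIV) (basic_rvs \<omega> S) (site_idx UNIV)"
    and ident: "\<And>x. distr M (count_space UNIV) (\<lambda>w. \<omega> w x)
                    = distr M (count_space UNIV) (\<lambda>w. \<omega> w 0)"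
    and nondeg: "prob {w \<in> space M. \<omega> w 0 \<noteq> 0} > 0"
    and start: "\<And>w x l. w \<in> space M \<Longrightarrow> S w x l 0 = x"
    and srw: "\<And>x l k. l \<ge> 1 \<Longrightarrow>
               distr M (count_space UNIV) (\<lambda>w. S w x l (Suc k) - S w x l k)
                 = measure_pmf (pmf_of_set {e :: int^'d. norm1 e = 1})"
    and mean: "integrable M (\<lambda>w. real (\<omega> w 0))"
begin

definition X :: "'a \<Rightarrow> 'd config" where
  "X w i = basic_rvs \<omega> S i w"

lemma measurable_X: "i \<in> site_idx UNIV \<Longrightarrow> (\<lambda>w. X w i) \<in> measurable M (count_space UNIV)"
  using indep unfolding indep_vars_def X_def by blast

lemma indep_X: "indep_vars (\<lambda>_. count_space UNIV) (\<lambda>i w. X w i) (site_idx UNIV)"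
  using indep unfolding X_def by simp

text \<open>\<open>X\<close> is known to be measurable only at indices in
  \<open>site_idx UNIV\<close>, which leave out label 0. Filling makes every coordinate measurable
  and does not change passage times.\<close>

abbreviation Z :: "'a \<Rightarrow> 'd config" where
  "Z w \<equiv> fill UNIV (X w)"

lemma measurable_Z: "(\<lambda>w. Z w i) \<in> measurable M (count_space UNIV)"
  by (rule measurable_fill) (rule measurable_X)

lemma om_of_Z: "om_of (Z w) x = \<omega> w x"
  by (simp add: om_of_def fill_def site_idx_def X_def basic_rvs_def)

lemma walk_of_Z: "w \<in> space M \<Longrightarrow> 1 \<le> l \<Longrightarrow> walk_of (Z w) x l k = S w x l k"
  using sum_lessThan_telescope[of "S w x l" k]
  by (simp add: walk_of_def fill_def site_idx_def X_def basic_rvs_def start)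

lemma config_fpt_Z: "w \<in> space M \<Longrightarrow> config_fpt (Z w) = fpt (\<omega> w) (S w)"
  by (rule fpt_cong) (auto simp: om_of_Z walk_of_Z)

lemma measurable_omega: "(\<lambda>w. \<omega> w x) \<in> measurable M (count_space UNIV)"
  using measurable_om_of[where Y = Z and x = x, OF measurable_Z] by (simp add: om_of_Z)

lemma measurable_incr:
  "1 \<le> l \<Longrightarrow> (\<lambda>w. S w x l (Suc k) - S w x l k) \<in> measurable M (count_space UNIV)"
  using measurable_compose[OF measurable_X[of "Inr (x, l, k)"], of projr "count_space UNIV"]
  by (simp add: X_def basic_rvs_def site_idx_def)

lemma measurable_walk: "1 \<le> l \<Longrightarrow> (\<lambda>w. S w x l k) \<in> measurable M (count_space UNIV)"
  using measurable_walk_of[where Y = Z and x = x and l = l and k = k, OF measurable_Z]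
  by (simp add: walk_of_Z cong: measurable_cong)

lemma prob_omega: "prob {w \<in> space M. Q (\<omega> w x)} = prob {w \<in> space M. Q (\<omega> w 0)}"
proof -
  have "prob {w \<in> space M. Q (\<omega> w y)} = measure (distr M (count_space UNIV) (\<lambda>w. \<omega> w y)) {n. Q n}" for y
    using measurable_omega[of y] by (subst measure_distr) (auto intro!: arg_cong[where f = prob])
  then show ?thesis by (simp add: ident[of x])
qed

lemma unit_vectors:
  shows "finite {e :: int^'d. norm1 e = 1}" "{e :: int^'d. norm1 e = 1} \<noteq> {}"
proof -
  show "finite {e :: int^'d. norm1 e = 1}"
    by (rule finite_subset[OF _ finite_norm1_cball[of 0 1]]) auto
  fix i :: 'd
  have "norm1 (axis i 1 :: int^'d) = (\<Sum>j\<in>UNIV. if j = i then 1 else 0)"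
    unfolding norm1_def by (intro sum.cong) (auto simp: axis_def)
  then have "norm1 (axis i 1 :: int^'d) = 1" by simp
  then show "{e :: int^'d. norm1 e = 1} \<noteq> {}" by blast
qed

lemma AE_incr: "1 \<le> l \<Longrightarrow> AE w in M. norm1 (S w x l (Suc k) - S w x l k) = 1"
proof -
  assume l: "1 \<le> l"
  have "AE e in measure_pmf (pmf_of_set {e :: int^'d. norm1 e = 1}). norm1 e = 1"
    using unit_vectors by (simp add: AE_measure_pmf_iff)
  then have "AE e in distr M (count_space UNIV) (\<lambda>w. S w x l (Suc k) - S w x l k). norm1 e = 1"
    unfolding srw[OF l, of x k] .
  then show ?thesis using measurable_incr[OF l, of x k] by (subst (asm) AE_distr_iff) auto
qed

lemma AE_nearest_neighbour: "AE w in M. nearest_neighbour (walk_of (Z w))"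
proof -
  have "AE w in M. \<forall>x l k. 1 \<le> l \<longrightarrow> norm1 (S w x l (Suc k) - S w x l k) = 1"
    unfolding AE_all_countable using AE_incr by (auto simp: AE_all_countable)
  with AE_space show ?thesis
    by eventually_elim (auto simp: nearest_neighbour_def start walk_of_Z)
qed

text \<open>An event read through \<open>fill (A v)\<close> uses only the randomness attached to the
  sites of \<open>A v\<close>. Disjoint site sets select disjoint groups of one independent
  family.\<close>

lemma prob_local_events:
  assumes W: "finite W" "W \<noteq> {}" "disjoint_family_on A W"
    and E: "\<And>v. v \<in> W \<Longrightarrow> Measurable.pred (config_space (A v)) (\<lambda>r. E v (fill (A v) r))"
  shows "prob {w \<in> space M. \<forall>v\<in>W. E v (fill (A v) (X w))}
       = (\<Prod>v\<in>W. prob {w \<in> space M. E v (fill (A v) (X w))})"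
proof -
  have "disjoint_family_on (\<lambda>v. site_idx (A v)) W"
    using W(3) by (force simp: disjoint_family_on_def site_idx_def)
  then have "indep_vars (\<lambda>v. config_space (A v)) (\<lambda>v w. restrict (X w) (site_idx (A v))) W"
    by (intro indep_vars_restrict[OF indep_X]) (auto simp: site_idx_def)
  then have "indep_events (\<lambda>v. {w \<in> space M. E v (fill (A v) (restrict (X w) (site_idx (A v))))}) W"
    by (rule indep_eventsI_indep_vars) (use E in \<open>simp add: pred_def\<close>)
  moreover have "fill B (restrict r (site_idx B)) = fill B r" for B and r :: "'d config"
    by (auto simp: fill_def fun_eq_iff)
  ultimately have "indep_events (\<lambda>v. {w \<in> space M. E v (fill (A v) (X w))}) W" by simp
  then have "prob (\<Inter>v\<in>W. {w \<in> space M. E v (fill (A v) (X w))})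
      = (\<Prod>v\<in>W. prob {w \<in> space M. E v (fill (A v) (X w))})"
    using W unfolding indep_events_def by blast
  moreover have "(\<Inter>v\<in>W. {w \<in> space M. E v (fill (A v) (X w))})
      = {w \<in> space M. \<forall>v\<in>W. E v (fill (A v) (X w))}" using W(2) by auto
  ultimately show ?thesis by simp
qed

section \<open>Translation invariance of the law\<close>

text \<open>By independence both joint laws are products of their marginals, and the marginals at
  \<open>i\<close> and at the translated index agree: by \<open>ident\<close> for the frog numbers,
  by \<open>srw\<close> for the increments.\<close>

lemma distr_shift_X:
  "distr M (config_space UNIV) (\<lambda>w. restrict (shift a (X w)) (site_idx UNIV))
     = distr M (config_space UNIV) (\<lambda>w. restrict (X w) (site_idx UNIV))"
proof -
  define f :: "(int^'d) + ((int^'d) \<times> nat \<times> nat) \<Rightarrow> (int^'d) + ((int^'d) \<times> nat \<times> nat)"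
    where "f i = (case i of Inl x \<Rightarrow> Inl (x + a) | Inr (x, l, k) \<Rightarrow> Inr (x + a, l, k))" for i
  let ?I = "site_idx UNIV :: ((int^'d) + ((int^'d) \<times> nat \<times> nat)) set"
  have sX: "shift a (X w) i = X w (f i)" for w i by (simp add: shift_def f_def)
  have fI: "f i \<in> ?I" if "i \<in> ?I" for i using that by (auto simp: site_idx_def f_def)
  have inj: "inj_on f ?I"
    by (auto simp: inj_on_def f_def split: sum.splits)
  have ne: "?I \<noteq> {}" by (auto simp: site_idx_def)
  have "indep_vars (\<lambda>_. count_space UNIV) (\<lambda>i w. X w i) (f ` ?I)"
    by (rule indep_vars_subset[OF indep_X]) (use fI in auto)
  from indep_vars_reindex[OF this inj]
  have ind: "indep_vars (\<lambda>_. count_space UNIV) (\<lambda>i w. X w (f i)) ?I" .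
  have marg: "distr M (count_space UNIV) (\<lambda>w. X w (f i)) = distr M (count_space UNIV) (\<lambda>w. X w i)"
    if i: "i \<in> ?I" for i
  proof (cases i)
    case (Inl x)
    have "distr M (count_space UNIV) (\<lambda>w. X w (Inl y))
        = distr (distr M (count_space UNIV) (\<lambda>w. \<omega> w y)) (count_space UNIV) Inl" for y
      using measurable_omega[of y] by (subst distr_distr) (auto simp: X_def basic_rvs_def comp_def)
    then show ?thesis using Inl ident[of x] ident[of "x + a"] by (simp add: f_def)
  next
    case (Inr q)
    obtain x l k where q: "q = (x, l, k)" by (cases q)
    have l: "1 \<le> l" using i Inr q by (auto simp: site_idx_def)
    have "distr M (count_space UNIV) (\<lambda>w. X w (Inr (y, l, k)))
        = distr (distr M (count_space UNIV) (\<lambda>w. S w y l (Suc k) - S w y l k)) (count_space UNIV) Inr" for y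
      using measurable_incr[OF l, of y k]
      by (subst distr_distr) (auto simp: X_def basic_rvs_def comp_def)
    then show ?thesis using Inr q l by (simp add: f_def srw)
  qed
  have "distr M (config_space UNIV) (\<lambda>w. \<lambda>i\<in>?I. X w (f i))
      = PiM ?I (\<lambda>i. distr M (count_space UNIV) (\<lambda>w. X w (f i)))"
    using ind by (subst (asm) indep_vars_iff_distr_eq_PiM'[OF ne]) (auto intro: measurable_X fI)
  also have "\<dots> = PiM ?I (\<lambda>i. distr M (count_space UNIV) (\<lambda>w. X w i))"
    using marg by (intro PiM_cong) auto
  also have "\<dots> = distr M (config_space UNIV) (\<lambda>w. \<lambda>i\<in>?I. X w i)"
    using indep_X by (subst (asm) indep_vars_iff_distr_eq_PiM'[OF ne]) (auto intro: measurable_X)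
  finally have "distr M (config_space UNIV) (\<lambda>w. \<lambda>i\<in>?I. X w (f i))
      = distr M (config_space UNIV) (\<lambda>w. \<lambda>i\<in>?I. X w i)" .
  moreover have "restrict (shift a (X w)) ?I = (\<lambda>i\<in>?I. X w (f i))" for w
    by (simp add: sX restrict_def fun_eq_iff)
  ultimately show ?thesis by simp
qed

lemma prob_shift:
  assumes E: "Measurable.pred (config_space UNIV) (\<lambda>r. E (fill UNIV r))"
  shows "prob {w \<in> space M. E (shift a (Z w))} = prob {w \<in> space M. E (Z w)}"
proof -
  let ?I = "site_idx UNIV :: ((int^'d) + ((int^'d) \<times> nat \<times> nat)) set"
  have *: "prob {w \<in> space M. E (fill UNIV (Y w))}
      = measure (distr M (config_space UNIV) (\<lambda>w. restrict (Y w) ?I))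
          {r \<in> space (config_space UNIV). E (fill UNIV r)}"
    if Y: "\<And>i. i \<in> ?I \<Longrightarrow> (\<lambda>w. Y w i) \<in> measurable M (count_space UNIV)" for Y
  proof -
    have m: "(\<lambda>w. restrict (Y w) ?I) \<in> measurable M (config_space UNIV)"
      by (rule measurable_restrict) (rule Y)
    have "fill UNIV (restrict r ?I) = fill UNIV r" for r
      by (auto simp: fill_def fun_eq_iff)
    then show ?thesis using E m
      by (subst measure_distr)
        (auto simp: pred_def intro!: arg_cong[where f = prob] dest: measurable_space[OF m])
  qed
  have "prob {w \<in> space M. E (fill UNIV (shift a (X w)))} = prob {w \<in> space M. E (fill UNIV (X w))}"
  proof (subst (1 2) *)
    fix i :: "(int^'d) + ((int^'d) \<times> nat \<times> nat)" assume "i \<in> ?I"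
    then show "(\<lambda>w. shift a (X w) i) \<in> measurable M (count_space UNIV)"
      unfolding shift_def by (intro measurable_X) (auto simp: site_idx_def)
  qed (simp_all add: measurable_X distr_shift_X)
  moreover have "fill UNIV (shift a r) = shift a (fill UNIV r)" for r
    by (auto simp: fill_def shift_def fun_eq_iff site_idx_def split: sum.splits)
  ultimately show ?thesis by simp
qed

section \<open>Deviations of the walks and long jumps\<close>

lemma expectation_incr_coord:
  assumes l: "1 \<le> l"
  shows "expectation (\<lambda>w. real_of_int ((S w x l (Suc k) - S w x l k) $ i)) = 0"
proof -
  let ?U = "{e :: int^'d. norm1 e = 1}"
  have "expectation (\<lambda>w. real_of_int ((S w x l (Suc k) - S w x l k) $ i))
      = (\<integral>e. real_of_int (e $ i) \<partial>distr M (count_space UNIV) (\<lambda>w. S w x l (Suc k) - S w x l k))"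
    using measurable_incr[OF l, of x k] by (subst integral_distr) auto
  also have "\<dots> = (\<Sum>e\<in>?U. real_of_int (e $ i)) / real (card ?U)"
    unfolding srw[OF l] using unit_vectors by (simp add: integral_pmf_of_set)
  \<comment> \<open>The set of unit vectors is invariant under negation, so the sum equals its own
    negative.\<close>
  also have "(\<Sum>e\<in>?U. real_of_int (e $ i)) = (\<Sum>e\<in>?U. real_of_int ((- e) $ i))"
    by (intro sum.reindex_bij_witness[of _ uminus uminus]) (auto simp: norm1_minus)
  then have "(\<Sum>e\<in>?U. real_of_int (e $ i)) = 0" by (simp add: sum_negf)
  finally show ?thesis by simp
qed

text \<open>Hoeffding's inequality for centred increments in [-1, 1]: the squared ranges add up to
  \<open>4 * k\<close>, which gives the exponent - 2 c^2 / (4 k).\<close>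

lemma prob_coord_deviation:
  assumes l: "1 \<le> l" and c: "0 < c" and k: "0 < k"
  shows "prob {w \<in> space M. \<bar>real_of_int ((S w x l k - x) $ i)\<bar> \<ge> c} \<le> 2 * exp (- c\<^sup>2 / (2 * real k))"
proof -
  define Y where "Y j w = real_of_int ((S w x l (Suc j) - S w x l j) $ i)" for j w
  have "indep_vars (\<lambda>_. count_space UNIV) (\<lambda>i w. X w i) ((\<lambda>j. Inr (x, l, j)) ` {..<k})"
    by (rule indep_vars_subset[OF indep_X]) (use l in \<open>auto simp: site_idx_def\<close>)
  from indep_vars_reindex[OF this]
  have "indep_vars (\<lambda>_. count_space UNIV) (\<lambda>j w. X w (Inr (x, l, j))) {..<k}"
    by (simp add: inj_on_def)
  from indep_vars_compose2[OF this, of "\<lambda>_ e. real_of_int (projr e $ i)" "\<lambda>_. borel"]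
  have ind: "indep_vars (\<lambda>_. borel) Y {..<k}"
    by (simp add: Y_def[abs_def] X_def basic_rvs_def)
  interpret Hoeffding_ineq M "{..<k}" Y "\<lambda>_. -1" "\<lambda>_. 1" "\<Sum>j<k. expectation (Y j)"
  proof unfold_locales
    show "AE w in M. Y j w \<in> {-1..1}" for j
      using AE_incr[OF l, of x j]
    proof eventually_elim
      case (elim w)
      then show ?case
        using abs_coord_le_norm1[of "S w x l (Suc j) - S w x l j" i] by (simp add: Y_def abs_le_iff)
    qed
  qed (use ind in auto)
  have mean0: "(\<Sum>j<k. expectation (Y j)) = 0"
    using expectation_incr_coord[OF l, of x _ i] by (simp add: Y_def[abs_def])
  have tele: "(\<Sum>j<k. Y j w) = real_of_int ((S w x l k - x) $ i)" if "w \<in> space M" for w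
    using sum_lessThan_telescope[of "\<lambda>j. real_of_int (S w x l j $ i)" k] that by (simp add: Y_def start)
  have "prob {w \<in> space M. \<bar>(\<Sum>j<k. Y j w) - (\<Sum>j<k. expectation (Y j))\<bar> \<ge> c}
      \<le> 2 * exp (- 2 * c\<^sup>2 / (\<Sum>j<k. (1 - (- 1))\<^sup>2))"
    using c k by (intro Hoeffding_ineq_abs_ge) auto
  moreover have "{w \<in> space M. \<bar>(\<Sum>j<k. Y j w) - (\<Sum>j<k. expectation (Y j))\<bar> \<ge> c}
      = {w \<in> space M. \<bar>real_of_int ((S w x l k - x) $ i)\<bar> \<ge> c}"
    using tele by (auto simp: mean0)
  moreover have "- 2 * c\<^sup>2 / (\<Sum>j<k. (1 - (- 1))\<^sup>2) = - c\<^sup>2 / (2 * real k)"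
    using k by (simp add: field_simps)
  ultimately show ?thesis by simp
qed

text \<open>Some coordinate carries at least the fraction 1 / d of the l1-norm, d being the
  dimension; the union over coordinates costs the prefactor. Replacing \<open>k\<close> by
  \<open>t\<close> in the exponent makes the bound uniform over all times up to
  \<open>t\<close>.\<close>

lemma prob_walk_far:
  assumes l: "1 \<le> l" and c: "0 < c" and t: "k \<le> t" "0 < t"
  shows "prob {w \<in> space M. norm1 (S w x l k - x) \<ge> c}
       \<le> 2 * real CARD('d) * exp (- (c / real CARD('d))\<^sup>2 / (2 * real t))"
proof (cases "k = 0")
  case True
  then have empty: "{w \<in> space M. norm1 (S w x l k - x) \<ge> c} = {}" using c by (auto simp: start)
  show ?thesis unfolding empty by simp
next
  case False
  let ?c = "c / real CARD('d)"
  let ?E = "\<lambda>i. {w \<in> space M. \<bar>real_of_int ((S w x l k - x) $ i)\<bar> \<ge> ?c}"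
  have c': "0 < ?c" using c by simp
  have meas: "{w \<in> space M. Q (S w x l k)} \<in> events" for Q
    using measurable_sets[OF measurable_walk[OF l, of x k], of "{s. Q s}"]
    by (simp add: vimage_def Int_def conj_commute)
  have E: "?E i \<in> events" for i by (rule meas)
  have "prob {w \<in> space M. norm1 (S w x l k - x) \<ge> c} \<le> prob (\<Union>i\<in>UNIV. ?E i)"
  proof (rule finite_measure_mono)
    show "{w \<in> space M. norm1 (S w x l k - x) \<ge> c} \<subseteq> (\<Union>i\<in>UNIV. ?E i)"
    proof clarify
      fix w assume "w \<in> space M" "c \<le> norm1 (S w x l k - x)"
      moreover obtain i where "?c \<le> real_of_int \<bar>(S w x l k - x) $ i\<bar>"
        using norm1_ge_iff_coord[of c "S w x l k - x"] calculation(2) by blast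
      ultimately show "w \<in> (\<Union>i\<in>UNIV. ?E i)" by auto
    qed
    show "(\<Union>i\<in>UNIV. ?E i) \<in> events" by (intro sets.finite_UN E) auto
  qed
  also have "\<dots> \<le> (\<Sum>i\<in>UNIV. prob (?E i))"
    by (intro finite_measure_subadditive_finite image_subsetI E) auto
  also have "\<dots> \<le> (\<Sum>i\<in>(UNIV :: 'd set). 2 * exp (- ?c\<^sup>2 / (2 * real t)))"
  proof (rule sum_mono)
    fix i :: 'd
    have "prob (?E i) \<le> 2 * exp (- ?c\<^sup>2 / (2 * real k))"
      by (rule prob_coord_deviation[OF l c']) (use False in simp)
    also have "\<dots> \<le> 2 * exp (- ?c\<^sup>2 / (2 * real t))"
      using t False by (auto intro!: divide_left_mono)
    finally show "prob (?E i) \<le> 2 * exp (- ?c\<^sup>2 / (2 * real t))" .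
  qed
  finally show ?thesis by simp
qed

text \<open>Radius and time horizon are both \<open>t\<close>: a path of cost at most
  \<open>t\<close> stays in this ball, and none of its legs lasts longer.\<close>

definition long_jump :: "nat \<Rightarrow> real \<Rightarrow> 'a \<Rightarrow> bool" where
  "long_jump t c w \<longleftrightarrow> (\<exists>y l k. norm1 y \<le> real t \<and> 1 \<le> l \<and> l \<le> \<omega> w y \<and> k \<le> t \<and>
     norm1 (S w y l k - y) \<ge> c)"

lemma pred_long_jump: "Measurable.pred M (long_jump t c)"
proof -
  have 1: "Measurable.pred M (\<lambda>w. l \<le> \<omega> w y)" for l y
    by (rule measurable_compose[OF measurable_omega]) simp
  have 2: "Measurable.pred M (\<lambda>w. norm1 (S w y l k - y) \<ge> c)" if "1 \<le> l" for y l k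
    by (rule measurable_compose[OF measurable_walk[OF that]]) simp
  have "Measurable.pred M (\<lambda>w. norm1 y \<le> real t \<and> 1 \<le> l \<and> l \<le> \<omega> w y \<and> k \<le> t \<and>
     norm1 (S w y l k - y) \<ge> c)" (is "Measurable.pred M ?P") for y l k
  proof (cases "norm1 y \<le> real t \<and> 1 \<le> l \<and> k \<le> t")
    case True
    then have "?P = (\<lambda>w. l \<le> \<omega> w y \<and> norm1 (S w y l k - y) \<ge> c)" by auto
    then show ?thesis using True by (simp only:) (intro pred_intros_logic 1 2, simp)
  next
    case False
    then have "?P = (\<lambda>_. False)" by (intro ext) blast
    then show ?thesis by (simp only:) simp
  qed
  then show ?thesis unfolding long_jump_def[abs_def] by (intro pred_intros_countable)
qed

text \<open>A union bound over sites, frogs and times is possible only for boundedly many frogs per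
  site. Sites with at least \<open>B\<close> frogs are discarded by Markov's inequality, all that a
  first moment offers. The free parameter \<open>B\<close> balances the two terms.\<close>

lemma prob_long_jump:
  assumes c: "0 < c" and t: "0 < t" and B: "0 < B"
  shows "prob {w \<in> space M. long_jump t c w} \<le> real ((2 * t + 1) ^ CARD('d)) *
     (expectation (\<lambda>w. real (\<omega> w 0)) / real B
       + real B * (real t + 1) * (2 * real CARD('d) * exp (- (c / real CARD('d))\<^sup>2 / (2 * real t))))"
    (is "_ \<le> real ?n * (?m / _ + ?b)")
proof -
  let ?A = "{y :: int^'d. norm1 y \<le> real t}"
  let ?F = "\<lambda>y. {w \<in> space M. real B \<le> real (\<omega> w y)}"
  let ?G = "\<lambda>y l k. {w \<in> space M. norm1 (S w y l k - y) \<ge> c}"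
  let ?e = "2 * real CARD('d) * exp (- (c / real CARD('d))\<^sup>2 / (2 * real t))"
  have A: "finite ?A" "card ?A \<le> ?n"
    using finite_norm1_cball[of 0 "real t"] card_norm1_cball_le[where r = t and a = "0 :: int^'d"]
    by simp_all
  have F: "?F y \<in> events" for y
  proof -
    have "Measurable.pred M (\<lambda>w. real B \<le> real (\<omega> w y))"
      by (rule measurable_compose[OF measurable_omega]) simp
    then show ?thesis by (simp add: pred_def)
  qed
  have G: "?G y l k \<in> events" if "1 \<le> l" for y l k
  proof -
    have "Measurable.pred M (\<lambda>w. norm1 (S w y l k - y) \<ge> c)"
      by (rule measurable_compose[OF measurable_walk[OF that]]) simp
    then show ?thesis by (simp add: pred_def)
  qed
  define H where "H y = ?F y \<union> (\<Union>l\<in>{1..B}. \<Union>k\<in>{..t}. ?G y l k)" for y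
  have HE: "H y \<in> events" for y
    unfolding H_def by (intro sets.Un F sets.finite_UN G) auto
  have "prob (H y) \<le> ?m / real B + ?b" for y
  proof -
    have "prob (?F y) = prob (?F 0)" by (rule prob_omega)
    also have "\<dots> \<le> ?m / real B"
      using B by (intro integral_Markov_inequality_measure[OF mean, of "{}"]) auto
    finally have 1: "prob (?F y) \<le> ?m / real B" .
    have "prob (\<Union>l\<in>{1..B}. \<Union>k\<in>{..t}. ?G y l k) \<le> (\<Sum>l\<in>{1..B}. prob (\<Union>k\<in>{..t}. ?G y l k))"
      by (intro finite_measure_subadditive_finite image_subsetI sets.finite_UN G) auto
    also have "\<dots> \<le> (\<Sum>l\<in>{1..B}. \<Sum>k\<in>{..t}. prob (?G y l k))"
      by (intro sum_mono finite_measure_subadditive_finite image_subsetI G) auto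
    also have "\<dots> \<le> (\<Sum>l\<in>{1..B}. \<Sum>k\<in>{..t}. ?e)"
      by (intro sum_mono prob_walk_far c t) auto
    also have "\<dots> = ?b" by simp
    finally have 2: "prob (\<Union>l\<in>{1..B}. \<Union>k\<in>{..t}. ?G y l k) \<le> ?b" .
    have "prob (H y) \<le> prob (?F y) + prob (\<Union>l\<in>{1..B}. \<Union>k\<in>{..t}. ?G y l k)"
      unfolding H_def by (intro measure_Un_le F sets.finite_UN G) auto
    then show ?thesis using 1 2 by linarith
  qed
  then have Hb: "(\<Sum>y\<in>?A. prob (H y)) \<le> real (card ?A) * (?m / real B + ?b)"
    by (rule sum_bounded_above)
  have "prob {w \<in> space M. long_jump t c w} \<le> prob (\<Union>y\<in>?A. H y)"
  proof (rule finite_measure_mono)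
    show "{w \<in> space M. long_jump t c w} \<subseteq> (\<Union>y\<in>?A. H y)"
    proof clarify
      fix w assume w: "w \<in> space M" "long_jump t c w"
      then obtain y l k where *: "norm1 y \<le> real t" "1 \<le> l" "l \<le> \<omega> w y" "k \<le> t"
        "norm1 (S w y l k - y) \<ge> c" unfolding long_jump_def by blast
      have "w \<in> H y"
      proof (cases "B \<le> \<omega> w y")
        case False
        then have "l \<in> {1..B}" using * by simp
        then show ?thesis unfolding H_def using w * by blast
      qed (use w in \<open>simp add: H_def\<close>)
      then show "w \<in> (\<Union>y\<in>?A. H y)" using * by blast
    qed
  qed (use A HE in auto)
  also have "\<dots> \<le> (\<Sum>y\<in>?A. prob (H y))"
    using A HE by (intro finite_measure_subadditive_finite) auto
  also note Hb
  also have "real (card ?A) * (?m / real B + ?b) \<le> real ?n * (?m / real B + ?b)"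
    using A by (intro mult_right_mono of_nat_mono add_nonneg_nonneg) auto
  finally show ?thesis .
qed

end

section \<open>Probability of bad blocks\<close>

locale frog_time_constant = frog_model M \<omega> S + discrete_norm m C
  for M :: "'a measure" and \<omega> :: "'a \<Rightarrow> int^'d \<Rightarrow> nat"
    and S :: "'a \<Rightarrow> int^'d \<Rightarrow> nat \<Rightarrow> nat \<Rightarrow> int^'d" and m :: "int^'d \<Rightarrow> real" and C :: real +
  assumes time_constant: "\<And>\<delta>. 0 < \<delta> \<Longrightarrow> AE w in M. 1 \<le> \<omega> w 0 \<longrightarrow>
    (\<exists>r. \<forall>x. r \<le> norm1 x \<longrightarrow>
      (\<exists>k. fpt (\<omega> w) (S w) 0 x = enat k \<and> \<bar>real k - m x\<bar> \<le> \<delta> * norm1 x))"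
begin

text \<open>Failure of the shape theorem around an occupied site. Unlike \<open>good\<close> it has
  no mask and no upper limit on the distance: it depends on all sites, but decreases in
  \<open>s\<close>.\<close>

definition atypical :: "real \<Rightarrow> nat \<Rightarrow> int^'d \<Rightarrow> 'd config \<Rightarrow> bool" where
  "atypical \<delta> s a r \<longleftrightarrow> 1 \<le> om_of r a \<and> (\<exists>y. real s \<le> norm1 (y - a) \<and>
     \<not> (\<exists>k. config_fpt r a y = enat k \<and> \<bar>real k - m (y - a)\<bar> \<le> \<delta> * norm1 (y - a)))"

lemma atypical_shift: "atypical \<delta> s 0 (shift a r) \<longleftrightarrow> atypical \<delta> s a r"
proof -
  have ex: "(\<exists>y. Q (y + a)) \<longleftrightarrow> (\<exists>y. Q y)" for Q :: "int^'d \<Rightarrow> bool"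
    by (metis diff_add_cancel)
  show ?thesis
    unfolding atypical_def config_fpt_shift om_of_shift
    using ex[of "\<lambda>y. real s \<le> norm1 (y - a) \<and>
     \<not> (\<exists>k. config_fpt r a y = enat k \<and> \<bar>real k - m (y - a)\<bar> \<le> \<delta> * norm1 (y - a))"]
    by simp
qed

lemma pred_atypical:
  assumes Y: "\<And>i. (\<lambda>w. Y w i) \<in> measurable N (count_space UNIV)"
  shows "Measurable.pred N (\<lambda>w. atypical \<delta> s a (Y w))"
proof -
  have 1: "Measurable.pred N (\<lambda>w. 1 \<le> om_of (Y w) a)"
    by (rule measurable_compose[OF measurable_om_of[OF Y]]) simp
  have 2: "Measurable.pred N (\<lambda>w. Q (config_fpt (Y w) a y))" for y Q
    by (rule measurable_compose[OF measurable_config_fpt[OF Y]]) simp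
  have 3: "Measurable.pred N (\<lambda>w. real s \<le> norm1 (y - a) \<and>
     \<not> (\<exists>k. config_fpt (Y w) a y = enat k \<and> \<bar>real k - m (y - a)\<bar> \<le> \<delta> * norm1 (y - a)))" for y
    by (rule 2)
  show ?thesis unfolding atypical_def by (intro pred_intros_logic pred_intros_countable 1 3)
qed

lemma events_atypical: "{w \<in> space M. atypical \<delta> s a (Z w)} \<in> events"
  using pred_atypical[of Z, OF measurable_Z] by (simp add: pred_def)

lemma prob_atypical_shift:
  "prob {w \<in> space M. atypical \<delta> s a (Z w)} = prob {w \<in> space M. atypical \<delta> s 0 (Z w)}"
  using prob_shift[of "atypical \<delta> s 0" a] pred_atypical[of "fill UNIV", OF measurable_fill_config_space]
  by (simp add: atypical_shift)

text \<open>The events decrease in \<open>s\<close>, and the time constant makes their intersection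
  a null set; continuity from above then gives the limit.\<close>

lemma prob_atypical_tendsto_0:
  assumes "0 < \<delta>"
  shows "(\<lambda>s. prob {w \<in> space M. atypical \<delta> s 0 (Z w)}) \<longlonglongrightarrow> 0"
proof -
  let ?A = "\<lambda>s. {w \<in> space M. atypical \<delta> s 0 (Z w)}"
  have "decseq ?A"
    unfolding decseq_def atypical_def by (auto intro: order_trans[of "real _" "real _"]) (meson of_nat_mono order_trans)
  then have "(\<lambda>s. prob (?A s)) \<longlonglongrightarrow> prob (\<Inter>s. ?A s)"
    using events_atypical by (intro finite_Lim_measure_decseq) auto
  moreover have "AE w in M. w \<notin> (\<Inter>s. ?A s)"
    using time_constant[OF assms] AE_space
  proof eventually_elim
    case (elim w)
    show ?case
    proof
      assume *: "w \<in> (\<Inter>s. ?A s)"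
      then have "1 \<le> \<omega> w 0" by (auto simp: atypical_def om_of_Z)
      then obtain r where r: "\<And>x. r \<le> norm1 x \<Longrightarrow>
          (\<exists>k. fpt (\<omega> w) (S w) 0 x = enat k \<and> \<bar>real k - m x\<bar> \<le> \<delta> * norm1 x)"
        using elim by blast
      have "atypical \<delta> (nat \<lceil>r\<rceil>) 0 (Z w)" using * by blast
      then obtain y where "real (nat \<lceil>r\<rceil>) \<le> norm1 y"
        "\<not> (\<exists>k. fpt (\<omega> w) (S w) 0 y = enat k \<and> \<bar>real k - m y\<bar> \<le> \<delta> * norm1 y)"
        unfolding atypical_def config_fpt_Z[OF elim(2)] by auto
      moreover have "r \<le> real (nat \<lceil>r\<rceil>)" by linarith
      ultimately show False using r[of y] by simp
    qed
  qed
  then have "prob (\<Inter>s. ?A s) = 0"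
    using events_atypical by (subst prob_eq_0) auto
  ultimately show ?thesis by simp
qed

text \<open>For a typical occupied site all passage times within distance \<open>L\<close> are at
  most \<open>(C + \<delta>) * L \<le> R\<close>, so the mask does not alter them.\<close>

lemma not_good_imp:
  assumes nn: "nearest_neighbour (walk_of r)" and \<delta>: "0 \<le> \<delta>" and R: "(C + \<delta>) * L \<le> R"
    and "\<not> good m \<delta> s L R (om_of r) (walk_of r) a"
  shows "om_of r a = 0 \<or> atypical \<delta> s a r"
proof (rule ccontr)
  assume *: "\<not> ?thesis"
  have "good m \<delta> s L R (om_of r) (walk_of r) a"
    unfolding good_def
  proof (intro allI impI)
    fix y assume y: "real s \<le> norm1 (y - a) \<and> norm1 (y - a) \<le> L"
    then obtain k where k: "config_fpt r a y = enat k" "\<bar>real k - m (y - a)\<bar> \<le> \<delta> * norm1 (y - a)"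
      using * unfolding atypical_def by (auto simp: Suc_le_eq)
    have "real k \<le> m (y - a) + \<delta> * norm1 (y - a)" using k(2) by linarith
    also have "\<dots> \<le> (C + \<delta>) * norm1 (y - a)" using m_le[of "y - a"] by (simp add: distrib_right)
    also have "\<dots> \<le> (C + \<delta>) * L" using y C_nonneg \<delta> by (intro mult_left_mono) auto
    also note R
    finally have "fpt (mask {z. norm1 (z - a) \<le> R} (om_of r)) (walk_of r) a y \<le> enat k"
      using fpt_mask_le[OF nn, of "om_of r" a y k R] k(1) by simp
    moreover have "enat k \<le> fpt (mask {z. norm1 (z - a) \<le> R} (om_of r)) (walk_of r) a y"
      using fpt_mask_ge[of "om_of r" "walk_of r" a y] k(1) by metis
    ultimately show "\<exists>k. fpt (mask {z. norm1 (z - a) \<le> R} (om_of r)) (walk_of r) a y = enat k \<and>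
        \<bar>real k - m (y - a)\<bar> \<le> \<delta> * norm1 (y - a)"
      using k(2) antisym by blast
  qed
  then show False using assms by blast
qed

abbreviation bad :: "real \<Rightarrow> nat \<Rightarrow> real \<Rightarrow> real \<Rightarrow> nat \<Rightarrow> int^'d \<Rightarrow> 'd config \<Rightarrow> bool" where
  "bad \<delta> s L R N v r \<equiv> bad_block m \<delta> s L R N (om_of r) (walk_of r) v"

lemma inj_cand: "inj (cand s v :: nat \<Rightarrow> int^'d)"
proof (rule injI)
  fix j k assume "cand s v j = cand s v k"
  then have "cand s v j $ i = cand s v k $ i" for i by simp
  then show "j = k" by (simp add: cand_def)
qed

text \<open>Either all \<open>N\<close> candidates are empty, which are independent events at
  distinct sites, or some occupied candidate is atypical, which is handled by a union bound and
  translation invariance.\<close>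

lemma prob_bad_le:
  assumes \<delta>: "0 < \<delta>" and R: "(C + \<delta>) * L \<le> R" and N: "0 < N"
  shows "prob {w \<in> space M. bad \<delta> s L R N v (Z w)}
    \<le> prob {w \<in> space M. \<omega> w 0 = 0} ^ N + real N * prob {w \<in> space M. atypical \<delta> s 0 (Z w)}"
proof -
  let ?W = "cand s v ` {..<N} :: (int^'d) set"
  have "prob {w \<in> space M. \<forall>a\<in>?W. om_of (fill {a} (X w)) a = 0}
      = (\<Prod>a\<in>?W. prob {w \<in> space M. om_of (fill {a} (X w)) a = 0})"
  proof (rule prob_local_events)
    fix a :: "int^'d"
    show "Measurable.pred (config_space {a}) (\<lambda>r. om_of (fill {a} r) a = 0)"
      by (rule measurable_compose[OF measurable_om_of[OF measurable_fill_config_space]]) simp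
  qed (use N in \<open>auto simp: disjoint_family_on_def\<close>)
  moreover have om: "om_of (fill {a} (X w)) a = \<omega> w a" for a w
    by (simp add: om_of_def fill_def site_idx_def X_def basic_rvs_def)
  moreover have "(\<Prod>a\<in>?W. prob {w \<in> space M. \<omega> w a = 0}) = prob {w \<in> space M. \<omega> w 0 = 0} ^ N"
  proof -
    have "(\<Prod>a\<in>?W. prob {w \<in> space M. \<omega> w a = 0}) = (\<Prod>a\<in>?W. prob {w \<in> space M. \<omega> w 0 = 0})"
      by (intro prod.cong refl prob_omega[of "\<lambda>n. n = 0"])
    then show ?thesis using card_image[OF inj_on_subset[OF inj_cand], of "{..<N}" s v] by simp
  qed
  ultimately have zero: "prob {w \<in> space M. \<forall>a\<in>?W. \<omega> w a = 0} = prob {w \<in> space M. \<omega> w 0 = 0} ^ N"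
    by simp
  have om0: "{w \<in> space M. \<forall>a\<in>?W. \<omega> w a = 0} \<in> events"
  proof -
    have "Measurable.pred M (\<lambda>w. \<omega> w a = 0)" for a
      by (rule measurable_compose[OF measurable_omega]) simp
    then have "Measurable.pred M (\<lambda>w. \<forall>a\<in>?W. \<omega> w a = 0)" by (intro pred_intros_finite) auto
    then show ?thesis by (simp add: pred_def)
  qed
  have "prob {w \<in> space M. bad \<delta> s L R N v (Z w)}
      \<le> prob ({w \<in> space M. \<forall>a\<in>?W. \<omega> w a = 0} \<union> (\<Union>a\<in>?W. {w \<in> space M. atypical \<delta> s a (Z w)}))"
  proof (rule finite_measure_mono_AE)
    show "AE w in M. w \<in> {w \<in> space M. bad \<delta> s L R N v (Z w)} \<longrightarrow>
        w \<in> {w \<in> space M. \<forall>a\<in>?W. \<omega> w a = 0} \<union> (\<Union>a\<in>?W. {w \<in> space M. atypical \<delta> s a (Z w)})"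
      using AE_nearest_neighbour
    proof eventually_elim
      case (elim w)
      have *: "\<omega> w a = 0 \<or> atypical \<delta> s a (Z w)" if "bad \<delta> s L R N v (Z w)" "a \<in> ?W" for a
        using not_good_imp[OF elim _ R, of s a] that \<delta> by (auto simp: bad_block_def om_of_Z)
      show ?case
      proof
        assume w: "w \<in> {w \<in> space M. bad \<delta> s L R N v (Z w)}"
        show "w \<in> {w \<in> space M. \<forall>a\<in>?W. \<omega> w a = 0} \<union> (\<Union>a\<in>?W. {w \<in> space M. atypical \<delta> s a (Z w)})"
        proof (cases "\<forall>a\<in>?W. \<omega> w a = 0")
          case False
          then obtain a where a: "a \<in> ?W" "\<omega> w a \<noteq> 0" by blast
          then have "atypical \<delta> s a (Z w)" using *[of a] w by simp
          then have "w \<in> {w \<in> space M. atypical \<delta> s a (Z w)}" using w by simp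
          then show ?thesis using a(1) by (rule UnI2[OF UN_I[rotated]])
        qed (use w in simp)
      qed
    qed
    show "{w \<in> space M. \<forall>a\<in>?W. \<omega> w a = 0} \<union> (\<Union>a\<in>?W. {w \<in> space M. atypical \<delta> s a (Z w)}) \<in> events"
      by (intro sets.Un om0 sets.finite_UN events_atypical) auto
  qed
  also have "\<dots> \<le> prob {w \<in> space M. \<forall>a\<in>?W. \<omega> w a = 0}
      + prob (\<Union>a\<in>?W. {w \<in> space M. atypical \<delta> s a (Z w)})"
    by (intro measure_Un_le om0 sets.finite_UN events_atypical) auto
  also have "prob (\<Union>a\<in>?W. {w \<in> space M. atypical \<delta> s a (Z w)})
      \<le> (\<Sum>a\<in>?W. prob {w \<in> space M. atypical \<delta> s a (Z w)})"
    by (intro finite_measure_subadditive_finite image_subsetI events_atypical) auto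
  also have "(\<Sum>a\<in>?W. prob {w \<in> space M. atypical \<delta> s a (Z w)})
      = (\<Sum>a\<in>?W. prob {w \<in> space M. atypical \<delta> s 0 (Z w)})"
    by (intro sum.cong refl prob_atypical_shift)
  also have "\<dots> = real N * prob {w \<in> space M. atypical \<delta> s 0 (Z w)}"
    using card_image[OF inj_on_subset[OF inj_cand], of "{..<N}" s v] by simp
  finally show ?thesis using zero by simp
qed

text \<open>The order of choice matters: \<open>N\<close> makes it unlikely that all candidates are
  empty, then \<open>s\<close> large makes \<open>N\<close> times the atypical probability small.
  The estimate is uniform in \<open>L\<close>, \<open>R\<close> and \<open>v\<close>, so these may
  vary with \<open>s\<close> later.\<close>

lemma eventually_prob_bad_le:
  assumes \<delta>: "0 < \<delta>" and q: "0 < q"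
  obtains N where "\<forall>\<^sub>F s in sequentially. N \<le> s \<and>
    (\<forall>L R v. (C + \<delta>) * L \<le> R \<longrightarrow> prob {w \<in> space M. bad \<delta> s L R N v (Z w)} \<le> q)"
proof -
  let ?p = "prob {w \<in> space M. \<omega> w 0 = 0}"
  have E: "{w \<in> space M. \<omega> w 0 = 0} \<in> events"
    using measurable_sets[OF measurable_omega[of 0], of "{0}"] by (simp add: vimage_def Int_def conj_commute)
  have "space M - {w \<in> space M. \<omega> w 0 = 0} = {w \<in> space M. \<omega> w 0 \<noteq> 0}" by auto
  then have "prob {w \<in> space M. \<omega> w 0 \<noteq> 0} = 1 - ?p"
    using prob_compl[OF E] by simp
  then have "?p < 1" using nondeg by linarith
  then have "(\<lambda>N. ?p ^ N) \<longlonglongrightarrow> 0" by (intro LIMSEQ_power_zero) auto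
  then have "\<forall>\<^sub>F N in sequentially. ?p ^ N < q / 2" using q by (intro order_tendstoD(2)) auto
  then have "\<forall>\<^sub>F N in sequentially. ?p ^ N < q / 2 \<and> 0 < N"
    by (rule eventually_conj) (rule eventually_gt_at_top)
  then obtain N where N: "?p ^ N < q / 2" "0 < N"
    by (auto simp: eventually_sequentially)
  have "(\<lambda>s. real N * prob {w \<in> space M. atypical \<delta> s 0 (Z w)}) \<longlonglongrightarrow> real N * 0"
    by (intro tendsto_intros prob_atypical_tendsto_0 \<delta>)
  then have "\<forall>\<^sub>F s in sequentially. real N * prob {w \<in> space M. atypical \<delta> s 0 (Z w)} < q / 2"
    using q by (intro order_tendstoD(2)) auto
  then have "\<forall>\<^sub>F s in sequentially. N \<le> s \<and>
    (\<forall>L R v. (C + \<delta>) * L \<le> R \<longrightarrow> prob {w \<in> space M. bad \<delta> s L R N v (Z w)} \<le> q)"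
    using eventually_ge_at_top[of N]
  proof eventually_elim
    case (elim s)
    show ?case
    proof (intro conjI allI impI)
      fix L R :: real and v :: "int^'d" assume "(C + \<delta>) * L \<le> R"
      from prob_bad_le[OF \<delta> this N(2), of s v] show "prob {w \<in> space M. bad \<delta> s L R N v (Z w)} \<le> q"
        using N(1) elim by linarith
    qed (use elim in simp)
  qed
  then show thesis by (rule that)
qed

text \<open>In each coordinate a candidate is within \<open>2 * s\<close> of the block corner, and
  its event reads only the ball of radius \<open>R\<close> around it.\<close>

lemma bad_fill:
  assumes "N \<le> s" "{x. norm1 (x - (\<chi> i. int s * v $ i)) \<le> R + 2 * real CARD('d) * real s} \<subseteq> A"
  shows "bad \<delta> s L R N v (fill A r) \<longleftrightarrow> bad \<delta> s L R N v r"
proof -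
  have "{z. norm1 (z - cand s v j) \<le> R} \<subseteq> A" if "j < N" for j
  proof -
    have "norm1 (cand s v j - (\<chi> i. int s * v $ i)) \<le> real CARD('d) * (2 * real s)"
    proof (rule norm1_le_card)
      fix i show "real_of_int \<bar>(cand s v j - (\<chi> i. int s * v $ i)) $ i\<bar> \<le> 2 * real s"
        using that assms(1) by (simp add: cand_def)
    qed
    then have "norm1 (z - (\<chi> i. int s * v $ i)) \<le> R + 2 * real CARD('d) * real s"
      if "norm1 (z - cand s v j) \<le> R" for z
      using norm1_triangle_diff[of z "\<chi> i. int s * v $ i" "cand s v j"] that by simp
    then show ?thesis using assms(2) by blast
  qed
  then have "good m \<delta> s L R (om_of (fill A r)) (walk_of (fill A r)) (cand s v j)
      \<longleftrightarrow> good m \<delta> s L R (om_of r) (walk_of r) (cand s v j)" if "j < N" for j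
    using that by (simp add: good_def mask_fill)
  then show ?thesis unfolding bad_block_def by blast
qed

text \<open>The corners of two blocks of \<open>W\<close> differ in some coordinate by at least
  \<open>D * s\<close>, more than twice the radius on which badness depends. The balls are disjoint
  and the events independent.\<close>

lemma prob_all_bad_le:
  assumes q: "\<And>v. prob {w \<in> space M. bad \<delta> s L R N v (Z w)} \<le> q"
    and N: "N \<le> s" and D: "2 * (R + 2 * real CARD('d) * real s) < real (D * s)"
    and W: "finite W" "\<And>u v. u \<in> W \<Longrightarrow> v \<in> W \<Longrightarrow> u \<noteq> v \<Longrightarrow> \<exists>i. int D \<le> \<bar>u $ i - v $ i\<bar>"
  shows "prob {w \<in> space M. \<forall>v\<in>W. bad \<delta> s L R N v (Z w)} \<le> q ^ card W"
proof (cases "W = {}")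
  case False
  define A where "A v = {x. norm1 (x - (\<chi> i. int s * v $ i)) \<le> R + 2 * real CARD('d) * real s}"
    for v :: "int^'d"
  have bad_eq: "bad \<delta> s L R N v (Z w) \<longleftrightarrow> bad \<delta> s L R N v (fill (A v) (X w))" for v w
    using bad_fill[OF N, of v R "A v" \<delta> L "X w"] bad_fill[OF N, of v R UNIV \<delta> L "X w"]
    by (simp add: A_def)
  have "disjoint_family_on A W"
    unfolding disjoint_family_on_def
  proof (intro ballI impI)
    fix u v assume uv: "u \<in> W" "v \<in> W" "u \<noteq> v"
    obtain i where i: "int D \<le> \<bar>u $ i - v $ i\<bar>" using W(2)[OF uv] by blast
    show "A u \<inter> A v = {}"
    proof (rule ccontr)
      assume "A u \<inter> A v \<noteq> {}"
      then obtain x where x: "x \<in> A u" "x \<in> A v" by blast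
      let ?d = "(\<chi> i. int s * u $ i) - (\<chi> i. int s * v $ i) :: int^'d"
      have "norm1 ?d \<le> 2 * (R + 2 * real CARD('d) * real s)"
        using x norm1_triangle_diff[of "\<chi> i. int s * u $ i" "\<chi> i. int s * v $ i" x]
          norm1_minus_commute[of x "\<chi> i. int s * u $ i"] by (simp add: A_def)
      moreover have "?d $ i = int s * (u $ i - v $ i)" by (simp add: right_diff_distrib)
      then have "\<bar>?d $ i\<bar> = int s * \<bar>u $ i - v $ i\<bar>" by (simp add: abs_mult)
      then have "int s * int D \<le> \<bar>?d $ i\<bar>" using i by (simp add: mult_left_mono)
      then have "real_of_int (int s * int D) \<le> real_of_int \<bar>?d $ i\<bar>" by (rule of_int_le_iff[THEN iffD2])
      then have "real (D * s) \<le> norm1 ?d" using abs_coord_le_norm1[of ?d i] by (simp add: mult.commute)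
      ultimately show False using D by linarith
    qed
  qed
  then have "prob {w \<in> space M. \<forall>v\<in>W. bad \<delta> s L R N v (fill (A v) (X w))}
       = (\<Prod>v\<in>W. prob {w \<in> space M. bad \<delta> s L R N v (fill (A v) (X w))})"
    using W(1) False
    by (intro prob_local_events[where E = "\<lambda>v. bad \<delta> s L R N v"] pred_bad_block measurable_fill_config_space)
  then have "prob {w \<in> space M. \<forall>v\<in>W. bad \<delta> s L R N v (Z w)}
       = (\<Prod>v\<in>W. prob {w \<in> space M. bad \<delta> s L R N v (Z w)})"
    by (simp add: bad_eq)
  also have "\<dots> \<le> (\<Prod>v\<in>W. q)" by (intro prod_mono) (auto intro: q)
  finally show ?thesis by simp
qed simp

text \<open>Writing G for \<open>(2 * Q + 1) ^ CARD('d)\<close>, there are at most G^j chains of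
  \<open>j\<close> steps, each with at most 2^(j+1) subsets as possible sets of bad blocks. Every
  large enough subset contains \<open>b\<close> separated blocks and costs \<open>q ^ b\<close>.
  Summing over \<open>j \<le> k\<close> gives a factor \<open>Suc k \<le> 2 ^ k\<close>, whence the
  base 4 G.\<close>

lemma prob_chain_bad_le:
  fixes D b Q k :: nat
  assumes q: "\<And>v. prob {w \<in> space M. bad \<delta> s L R N v (Z w)} \<le> q" "q \<le> 1"
    and N: "N \<le> s" and D: "2 * (R + 2 * real CARD('d) * real s) < real (D * s)" and D0: "0 < D"
  defines "B \<equiv> {w \<in> space M. \<exists>vs\<in>(\<Union>j\<le>k. block_chains Q j 0).
        D ^ CARD('d) * b \<le> card {v\<in>set vs. bad \<delta> s L R N v (Z w)}}"
  shows "B \<in> events \<and> prob B \<le> 2 * (4 * real ((2 * Q + 1) ^ CARD('d))) ^ k * q ^ b"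
proof -
  let ?G = "(2 * Q + 1) ^ CARD('d)"
  define Ch :: "nat \<Rightarrow> (int^'d) list set" where "Ch j = block_chains Q j 0" for j
  \<comment> \<open>The random set of bad blocks is enumerated through deterministic sets, so that
    independence is applied to a fixed set each time.\<close>
  define Sub where "Sub vs = {W. W \<subseteq> set vs \<and> D ^ CARD('d) * b \<le> card W}" for vs :: "(int^'d) list"
  define E where "E W = {w \<in> space M. \<forall>v\<in>W. bad \<delta> s L R N v (Z w)}" for W :: "(int^'d) set"
  have Ch: "finite (Ch j)" "card (Ch j) \<le> ?G ^ j" for j
    using card_block_chains_le[of Q j "0 :: int^'d"] by (auto simp: Ch_def)
  have Sub: "finite (Sub vs)" "card (Sub vs) \<le> 2 ^ length vs" for vs
  proof -
    have sub: "Sub vs \<subseteq> Pow (set vs)" by (auto simp: Sub_def)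
    then show "finite (Sub vs)" by (rule finite_subset) simp
    have "card (Sub vs) \<le> card (Pow (set vs))" by (rule card_mono[OF _ sub]) simp
    also have "\<dots> = 2 ^ card (set vs)" by (simp add: card_Pow)
    also have "\<dots> \<le> 2 ^ length vs" by (intro power_increasing card_length) auto
    finally show "card (Sub vs) \<le> 2 ^ length vs" .
  qed
  have q0: "0 \<le> q" using q(1)[of 0] measure_nonneg order_trans by blast
  have EE: "E W \<in> events" if "finite W" for W
  proof -
    have "Measurable.pred M (\<lambda>w. \<forall>v\<in>W. bad \<delta> s L R N v (Z w))"
      using that by (intro pred_intros_finite pred_bad_block measurable_Z)
    then show ?thesis by (simp add: E_def pred_def)
  qed
  have PE: "prob (E W) \<le> q ^ b" if "W \<in> Sub vs" for W vs
  proof -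
    have fin: "finite W" and card: "D ^ CARD('d) * b \<le> card W"
      using that finite_subset by (auto simp: Sub_def)
    obtain W' where W': "W' \<subseteq> W" "card W' = b"
      "\<And>u v. u \<in> W' \<Longrightarrow> v \<in> W' \<Longrightarrow> u \<noteq> v \<Longrightarrow> \<exists>i. int D \<le> \<bar>u $ i - v $ i\<bar>"
      using separated_subset[OF fin D0 card] by blast
    have fin': "finite W'" using W'(1) fin by (rule finite_subset)
    have "prob (E W) \<le> prob (E W')"
      using W'(1) by (intro finite_measure_mono EE fin') (auto simp: E_def)
    also have "\<dots> \<le> q ^ card W'"
      unfolding E_def by (rule prob_all_bad_le[OF q(1) N D fin' W'(3)])
    finally show ?thesis using W'(2) by simp
  qed
  have B_eq: "B = (\<Union>j\<le>k. \<Union>vs\<in>Ch j. \<Union>W\<in>Sub vs. E W)"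
  proof (intro equalityI subsetI)
    fix w assume "w \<in> B"
    then obtain j vs where "w \<in> space M" "j \<le> k" "vs \<in> Ch j"
      "{v\<in>set vs. bad \<delta> s L R N v (Z w)} \<in> Sub vs"
      by (auto simp: B_def Ch_def Sub_def)
    moreover from this have "w \<in> E {v\<in>set vs. bad \<delta> s L R N v (Z w)}" by (auto simp: E_def)
    ultimately show "w \<in> (\<Union>j\<le>k. \<Union>vs\<in>Ch j. \<Union>W\<in>Sub vs. E W)" by blast
  next
    fix w assume "w \<in> (\<Union>j\<le>k. \<Union>vs\<in>Ch j. \<Union>W\<in>Sub vs. E W)"
    then obtain j vs W where *: "j \<le> k" "vs \<in> Ch j" "W \<subseteq> set vs" "D ^ CARD('d) * b \<le> card W"
      "w \<in> space M" "\<forall>v\<in>W. bad \<delta> s L R N v (Z w)"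
      by (auto simp: Sub_def E_def)
    then have "card W \<le> card {v\<in>set vs. bad \<delta> s L R N v (Z w)}"
      by (intro card_mono) auto
    then show "w \<in> B" unfolding B_def using * by (auto simp: Ch_def intro: order_trans)
  qed
  have E3: "E W \<in> events" if "W \<in> Sub vs" for W vs
    using that by (intro EE) (auto simp: Sub_def intro: finite_subset)
  have E2: "(\<Union>W\<in>Sub vs. E W) \<in> events" for vs
    by (intro sets.finite_UN Sub E3)
  have E1: "(\<Union>vs\<in>Ch j. \<Union>W\<in>Sub vs. E W) \<in> events" for j
    by (intro sets.finite_UN Ch E2)
  have "B \<in> events" unfolding B_eq by (intro sets.finite_UN E1) auto
  have P2: "prob (\<Union>W\<in>Sub vs. E W) \<le> 2 ^ Suc j * q ^ b" if "vs \<in> Ch j" for vs j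
  proof -
    have "prob (\<Union>W\<in>Sub vs. E W) \<le> (\<Sum>W\<in>Sub vs. prob (E W))"
      by (intro finite_measure_subadditive_finite image_subsetI Sub E3)
    also have "\<dots> \<le> real (card (Sub vs)) * q ^ b" by (intro sum_bounded_above PE)
    also have "\<dots> \<le> real (2 ^ length vs) * q ^ b"
      using q0 Sub by (intro mult_right_mono of_nat_mono) auto
    finally show ?thesis using that by (simp add: Ch_def block_chains_def)
  qed
  have P1: "prob (\<Union>vs\<in>Ch j. \<Union>W\<in>Sub vs. E W) \<le> 2 * (2 * real ?G) ^ j * q ^ b" for j
  proof -
    have "prob (\<Union>vs\<in>Ch j. \<Union>W\<in>Sub vs. E W) \<le> (\<Sum>vs\<in>Ch j. prob (\<Union>W\<in>Sub vs. E W))"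
      by (intro finite_measure_subadditive_finite image_subsetI Ch E2)
    also have "\<dots> \<le> real (card (Ch j)) * (2 ^ Suc j * q ^ b)" by (intro sum_bounded_above P2)
    also have "\<dots> \<le> real (?G ^ j) * (2 ^ Suc j * q ^ b)"
      using q0 Ch[of j] by (intro mult_right_mono of_nat_mono) auto
    finally show ?thesis by (simp add: power_mult_distrib mult_ac)
  qed
  have "prob B \<le> (\<Sum>j\<le>k. prob (\<Union>vs\<in>Ch j. \<Union>W\<in>Sub vs. E W))"
    unfolding B_eq by (intro finite_measure_subadditive_finite image_subsetI E1) auto
  also have "\<dots> \<le> (\<Sum>j\<le>k. 2 * (2 * real ?G) ^ k * q ^ b)"
  proof (intro sum_mono order_trans[OF P1] mult_right_mono mult_left_mono power_increasing)
    have "1 \<le> ?G" by simp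
    then have "real 1 \<le> real ?G" by (rule of_nat_mono)
    then show "1 \<le> 2 * real ?G" by linarith
  qed (use q0 in auto)
  also have "\<dots> = real (Suc k) * (2 * (2 * real ?G) ^ k * q ^ b)" by simp
  also have "\<dots> \<le> 2 ^ k * (2 * (2 * real ?G) ^ k * q ^ b)"
  proof (intro mult_right_mono)
    have "Suc k \<le> 2 ^ k" using less_exp[of k] by (simp only: Suc_le_eq)
    then have "real (Suc k) \<le> real (2 ^ k)" by (rule of_nat_mono)
    then show "real (Suc k) \<le> 2 ^ k" by simp
  qed (use q0 in auto)
  also have "\<dots> = 2 * (2 * (2 * real ?G)) ^ k * q ^ b" by (simp only: power_mult_distrib mult_ac)
  finally show ?thesis using \<open>B \<in> events\<close> by simp
qed

text \<open>By the last hypothesis, the time \<open>t\<close>, the errors of \<open>k\<close> steps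
  and \<open>D ^ CARD('d) * b\<close> bad blocks together fail to account for \<open>m x\<close>. A
  fast passage without long jumps must therefore meet more bad blocks, along a chain of at most
  \<open>k\<close> steps since each step takes time at least \<open>K\<close>.\<close>

lemma prob_fast_passage_le:
  fixes H s N t D b k :: nat and L R \<delta> q :: real and x :: "int^'d"
  defines "K \<equiv> real (H * s)" and "c \<equiv> real CARD('d) * (3 * real s)"
  assumes q: "\<And>v. prob {w \<in> space M. bad \<delta> s L R N v (Z w)} \<le> q" "q \<le> 1"
    and s: "0 < s" "N \<le> s" and H: "3 * CARD('d) + 1 \<le> H"
    and L: "2 * K + c \<le> L" and R: "(C + \<delta>) * L \<le> R" and \<delta>: "0 \<le> \<delta>"
    and D: "2 * (R + 2 * real CARD('d) * real s) < real (D * s)" "0 < D"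
    and k: "real t < real (Suc k) * K"
    and m: "real t + real k * (2 * C * c + \<delta> * (2 * K + 2 * c))
       + 2 * C * K * real (D ^ CARD('d) * b) + C * K < m x"
  shows "prob {w \<in> space M. fpt (\<omega> w) (S w) 0 x \<le> enat t}
    \<le> prob {w \<in> space M. long_jump t K w} + 2 * (4 * real ((4 * H + 1) ^ CARD('d))) ^ k * q ^ b"
proof -
  define e where "e = 2 * C * c + \<delta> * (2 * K + 2 * c)"
  define B where "B = {w \<in> space M. \<exists>vs\<in>(\<Union>j\<le>k. block_chains (2 * H) j 0).
        D ^ CARD('d) * b \<le> card {v\<in>set vs. bad \<delta> s L R N v (Z w)}}"
  have B: "B \<in> events" "prob B \<le> 2 * (4 * real ((4 * H + 1) ^ CARD('d))) ^ k * q ^ b"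
    using prob_chain_bad_le[OF q s(2) D, where k = k and Q = "2 * H" and b = b]
    unfolding B_def by (simp_all add: mult.assoc[symmetric])
  have K0: "0 < K" using s H by (simp add: K_def)
  have c0: "0 \<le> c" by (simp add: c_def)
  have e0: "0 \<le> e" unfolding e_def using C_nonneg \<delta> K0 c0 by (auto intro!: add_nonneg_nonneg mult_nonneg_nonneg)
  have J: "{w \<in> space M. long_jump t K w} \<in> events" using pred_long_jump by (simp add: pred_def)
  have L0: "0 \<le> L" using L K0 c0 by linarith
  have R': "C * L \<le> R" using R \<delta> L0 by (simp add: distrib_right) (smt (verit) mult_nonneg_nonneg)
  have "prob {w \<in> space M. fpt (\<omega> w) (S w) 0 x \<le> enat t} \<le> prob ({w \<in> space M. long_jump t K w} \<union> B)"
  proof (rule finite_measure_mono_AE)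
    show "AE w in M. w \<in> {w \<in> space M. fpt (\<omega> w) (S w) 0 x \<le> enat t} \<longrightarrow>
        w \<in> {w \<in> space M. long_jump t K w} \<union> B"
      using AE_nearest_neighbour AE_space
    proof eventually_elim
      case (elim w)
      have "w \<in> B" if T: "fpt (\<omega> w) (S w) 0 x \<le> enat t" and nj: "\<not> long_jump t K w"
      proof -
        have short: "norm1 (walk_of (Z w) y l j - y) < K"
          if "norm1 y \<le> real t" "1 \<le> l" "l \<le> om_of (Z w) y" "j \<le> t" for y l j
        proof (rule ccontr)
          assume "\<not> ?thesis"
          then have "K \<le> norm1 (S w y l j - y)" using walk_of_Z[OF elim(2) that(2)] by simp
          then have "long_jump t K w"
            unfolding long_jump_def using that
            by (intro exI[of _ y] exI[of _ l] exI[of _ j]) (simp add: om_of_Z)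
          with nj show False ..
        qed
        have T': "config_fpt (Z w) 0 x \<le> enat t" using T by (simp add: config_fpt_Z[OF elim(2)])
        obtain vs where vs: "vs \<noteq> []" "hd vs = 0" "distinct vs"
          "successively (\<lambda>u v. \<forall>i. \<bar>v $ i - u $ i\<bar> \<le> 2 * int H) vs"
          "real (length vs - 1) * K \<le> real t"
          "m x \<le> real t + real (length vs - 1) * e
             + 2 * C * K * real (card {v\<in>set vs. bad \<delta> s L R N v (Z w)}) + C * K"
          using fast_passage_bad_blocks[OF elim(1) s H L[unfolded K_def c_def] R' \<delta> _ T'] short
          unfolding K_def c_def e_def by blast
        have "real (length vs - 1) * K < real (Suc k) * K" using vs(5) k by linarith
        then have len: "length vs - 1 \<le> k" using K0 by simp
        have "real (length vs - 1) * e \<le> real k * e" using len e0 by (intro mult_right_mono) auto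
        then have "2 * C * K * real (D ^ CARD('d) * b)
            < 2 * C * K * real (card {v\<in>set vs. bad \<delta> s L R N v (Z w)})"
          using vs(6) m unfolding e_def by linarith
        then have "real (D ^ CARD('d) * b) < real (card {v\<in>set vs. bad \<delta> s L R N v (Z w)})"
          by (rule mult_left_less_imp_less) (use C_nonneg K0 in auto)
        then have "D ^ CARD('d) * b \<le> card {v\<in>set vs. bad \<delta> s L R N v (Z w)}"
          by (simp only: of_nat_less_iff less_imp_le)
        moreover have "vs \<in> block_chains (2 * H) (length vs - 1) 0"
          using vs by (simp add: block_chains_def)
        ultimately show ?thesis unfolding B_def using len elim(2) by blast
      qed
      then show ?case using elim(2) by auto
    qed
    show "{w \<in> space M. long_jump t K w} \<union> B \<in> events" using J B(1) by (rule sets.Un)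
  qed
  also have "\<dots> \<le> prob {w \<in> space M. long_jump t K w} + prob B"
    using J B by (intro measure_Un_le)
  finally show ?thesis using B(2) by linarith
qed

end

section \<open>Choice of scales\<close>

text \<open>Put y = n powr (1/4). The term exp (- a y^2) outweighs exp y and all polynomial factors,
  so the bracket is at most exp (- 3 y / 4), and the power in front is at most exp (y / 4).\<close>

lemma long_jump_bound_asymptotics:
  fixes a b C E :: real and j :: nat
  assumes "0 < a" "0 < b" "0 < C"
  shows "\<forall>\<^sub>F n in at_top. (4 * C * n + 1) ^ j * (E * exp (- (n powr (1/4)))
     + 2 * exp (n powr (1/4)) * (2 * C * n + 1) * (b * exp (- (a * (n powr (1/4))\<^sup>2))))
     \<le> exp (- (n powr (1/4)) / 2)"
proof -
  \<comment> \<open>Chosen such that \<open>real j * \<eta> \<le> 1 / 4\<close>: the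
    \<open>j\<close>-th power then costs no more than the allotted exp (y / 4).\<close>
  define \<eta> where "\<eta> = 1 / (4 * (real j + 1))"
  have "0 < \<eta>" by (simp add: \<eta>_def)
  have j\<eta>: "real j * \<eta> \<le> 1 / 4" by (simp add: \<eta>_def field_simps)
  have 1: "\<forall>\<^sub>F n in at_top. 4 * C * n + 1 \<le> exp (\<eta> * n powr (1/4))"
    using \<open>0 < \<eta>\<close> \<open>0 < C\<close> by real_asymp
  have 2: "\<forall>\<^sub>F n in at_top. E \<le> exp (n powr (1/4) / 4 :: real) / 2"
    by real_asymp
  have 3: "\<forall>\<^sub>F n in at_top. 2 * exp (n powr (1/4)) * (2 * C * n + 1) *
      (b * exp (- (a * (n powr (1/4))\<^sup>2))) \<le> exp (- (3/4) * n powr (1/4) :: real) / 2"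
    using assms by real_asymp
  show ?thesis
    using 1 2 3 eventually_ge_at_top[of 0]
  proof eventually_elim
    case (elim n)
    let ?y = "n powr (1/4)"
    have pow: "(4 * C * n + 1) ^ j \<le> exp (?y / 4)"
    proof -
      have "(4 * C * n + 1) ^ j \<le> exp (\<eta> * ?y) ^ j"
        using elim(1,4) \<open>0 < C\<close> by (intro power_mono) auto
      also have "\<dots> = exp ((real j * \<eta>) * ?y)" by (simp add: exp_of_nat_mult[symmetric] mult.assoc)
      also have "\<dots> \<le> exp ((1 / 4) * ?y)"
        using j\<eta> by (intro exp_le_cancel_iff[THEN iffD2] mult_right_mono) auto
      finally show ?thesis by simp
    qed
    have "E * exp (- ?y) \<le> exp (?y / 4) / 2 * exp (- ?y)"
      using elim(2) by (intro mult_right_mono) auto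
    also have "\<dots> = exp (- (3/4) * ?y) / 2" by (simp add: exp_add[symmetric])
    finally have "E * exp (- ?y) + 2 * exp ?y * (2 * C * n + 1) * (b * exp (- (a * ?y\<^sup>2)))
        \<le> exp (- (3/4) * ?y)" (is "?z \<le> _") using elim(3) by linarith
    then have "(4 * C * n + 1) ^ j * ?z \<le> (4 * C * n + 1) ^ j * exp (- (3/4) * ?y)"
      using elim(4) \<open>0 < C\<close> by (intro mult_left_mono) auto
    also have "\<dots> \<le> exp (?y / 4) * exp (- (3/4) * ?y)" using pow by (intro mult_right_mono) auto
    also have "\<dots> = exp (- ?y / 2)" by (simp add: exp_add[symmetric])
    finally show ?case .
  qed
qed

context frog_time_constant
begin

text \<open>An occupied origin has positive probability, so an almost sure property holds at some
  outcome with frogs there. This converts the almost sure limit into inequalities for the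
  deterministic \<open>m\<close>.\<close>

lemma ex_typical_config:
  assumes "AE w in M. P w"
  shows "\<exists>w\<in>space M. P w \<and> 1 \<le> \<omega> w 0"
proof (rule ccontr)
  assume *: "\<not> ?thesis"
  have "AE w in M. w \<notin> {w \<in> space M. \<omega> w 0 \<noteq> 0}"
    using assms AE_space by eventually_elim (use * in \<open>auto simp: Suc_le_eq\<close>)
  moreover have ev: "{w \<in> space M. \<omega> w 0 \<noteq> 0} \<in> events"
    using measurable_sets[OF measurable_omega[of 0], of "- {0}"]
    by (simp add: vimage_def Int_def conj_commute)
  ultimately have "prob {w \<in> space M. \<omega> w 0 \<noteq> 0} = 0" by (subst prob_eq_0)
  with nondeg show False by simp
qed

text \<open>Walks move at speed one, so \<open>norm1\<close> bounds the passage times to large multiples of \<open>x\<close> from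
  below.\<close>

lemma norm1_le_m:
  assumes scale: "\<And>k. m (\<chi> i. int k * x $ i) = real k * m x"
  shows "norm1 x \<le> m x"
proof (cases "norm1 x = 0")
  case True
  have "norm1 (- x) = 0" using True by (simp add: norm1_minus)
  then have "m (x + - x) \<le> m x + m x" "m (x + - x) = 0 * m x"
    using m_add[of x "- x"] scale[of 0] by (simp_all add: m_minus zero_vec_def)
  then show ?thesis using True by simp
next
  case False
  then have n0: "0 < norm1 x" using norm1_nonneg[of x] by linarith
  have norm_scale: "norm1 (\<chi> i. int k * x $ i) = real k * norm1 x" for k
    by (simp add: norm1_def abs_mult sum_distrib_left)
  have "(1 - \<delta>) * norm1 x \<le> m x" if \<delta>: "0 < \<delta>" for \<delta>
  proof -
    have "AE w in M. nearest_neighbour (walk_of (Z w)) \<and> (1 \<le> \<omega> w 0 \<longrightarrow>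
      (\<exists>r. \<forall>x. r \<le> norm1 x \<longrightarrow>
        (\<exists>k. fpt (\<omega> w) (S w) 0 x = enat k \<and> \<bar>real k - m x\<bar> \<le> \<delta> * norm1 x)))"
      using AE_nearest_neighbour time_constant[OF \<delta>] by eventually_elim blast
    from ex_typical_config[OF this] obtain w where w: "w \<in> space M"
      and nn: "nearest_neighbour (walk_of (Z w))"
      and "\<exists>r. \<forall>x. r \<le> norm1 x \<longrightarrow>
        (\<exists>k. fpt (\<omega> w) (S w) 0 x = enat k \<and> \<bar>real k - m x\<bar> \<le> \<delta> * norm1 x)" by blast
    then obtain r where r: "\<And>x. r \<le> norm1 x \<Longrightarrow>
        (\<exists>k. fpt (\<omega> w) (S w) 0 x = enat k \<and> \<bar>real k - m x\<bar> \<le> \<delta> * norm1 x)" by blast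
    define k where "k = Suc (nat \<lceil>r / norm1 x\<rceil>)"
    have "r / norm1 x \<le> real k" unfolding k_def by linarith
    then have "r \<le> norm1 (\<chi> i. int k * x $ i)" using n0 by (simp add: norm_scale field_simps)
    then obtain j where j: "config_fpt (Z w) 0 (\<chi> i. int k * x $ i) = enat j"
      "\<bar>real j - real k * m x\<bar> \<le> \<delta> * (real k * norm1 x)"
      using r[of "\<chi> i. int k * x $ i"] by (auto simp: config_fpt_Z[OF w] scale norm_scale)
    have "real k * norm1 x \<le> real j"
      using norm1_le_fpt[OF nn, of "om_of (Z w)" 0 "\<chi> i. int k * x $ i" j] j(1) by (simp add: norm_scale)
    then have "real k * ((1 - \<delta>) * norm1 x) \<le> real k * m x"
      using j(2) by (simp add: algebra_simps abs_le_iff)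
    then show ?thesis by (rule mult_left_le_imp_le) (simp add: k_def)
  qed
  then have "\<forall>\<^sub>F \<delta> in at_right 0. (1 - \<delta>) * norm1 x \<le> m x"
    by (simp add: eventually_at_right_less eventually_at_filter)
  moreover have "((\<lambda>\<delta>. (1 - \<delta>) * norm1 x) \<longlongrightarrow> (1 - 0) * norm1 x) (at_right 0)"
    by (intro tendsto_intros)
  ultimately show ?thesis by (intro tendsto_upperbound[where F = "at_right (0::real)"]) auto
qed

text \<open>The gap between \<open>m x\<close> and the allowed time is at least \<epsilon> n - 1. A
  quarter of \<epsilon> n pays for the errors in good blocks, a quarter for the bad blocks, and half
  for the last piece of the path and the rounding.\<close>

lemma prob_fast_passage_exponential:
  assumes C1: "1 \<le> C" and m_ge: "\<And>x. norm1 x \<le> m x" and \<epsilon>: "0 < \<epsilon>" "\<epsilon> < 1"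
  obtains A \<kappa> n0 where "0 < A" "0 < \<kappa>"
    "\<And>x. n0 \<le> norm1 x \<Longrightarrow>
      prob {w \<in> space M. fpt (\<omega> w) (S w) 0 x \<le> enat (nat \<lfloor>(1 - \<epsilon>) * m x\<rfloor> + 1)}
        \<le> A * exp (- \<kappa> * norm1 x powr (1/4))"
proof -
  define d where "d = real CARD('d)"
  have d1: "1 \<le> d" using one_le_card_finite[where 'a = 'd] by (simp add: d_def)
  \<comment> \<open>The error of a good step has two parts, and each may be at most
    \<open>K * (\<epsilon> / (16 * C))\<close>. For \<open>2 * C * c = 6 * C * d * s\<close> this
    forces 96 C^2 d / \<epsilon>; for the other part it forces the value of \<open>\<delta>\<close>
    below.\<close>
  define H where "H = nat \<lceil>96 * C\<^sup>2 * d / \<epsilon>\<rceil> + 3 * CARD('d) + 1"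
  have H1: "3 * CARD('d) + 1 \<le> H" by (simp add: H_def)
  have "96 * C\<^sup>2 * d / \<epsilon> \<le> real H" unfolding H_def by linarith
  then have H2: "6 * C * d \<le> real H * (\<epsilon> / (16 * C))"
    using C1 \<epsilon> by (simp add: field_simps power2_eq_square)
  have H3: "3 * d + 1 \<le> real H" using of_nat_mono[OF H1, where 'a = real] by (simp add: d_def)
  define \<delta> where "\<delta> = \<epsilon> / (64 * C)"
  have \<delta>: "0 < \<delta>" using C1 \<epsilon> by (simp add: \<delta>_def)
  \<comment> \<open>With \<open>L\<close> and \<open>R\<close> as set later,
    \<open>R + 2 * d * s\<close> is a multiple of \<open>s\<close> by a constant. Hence the
    dependence range in units of blocks does not grow with \<open>n\<close>.\<close>
  define D where "D = nat \<lceil>2 * ((C + \<delta>) * (2 * real H + 3 * d) + 2 * d)\<rceil> + 1"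
  define P where "P = real (D ^ CARD('d))"
  have P1: "1 \<le> P"
  proof -
    have "1 \<le> D ^ CARD('d)" by (simp add: D_def)
    then have "real 1 \<le> P" unfolding P_def by (rule of_nat_mono)
    then show ?thesis by simp
  qed
  define G where "G = real ((4 * H + 1) ^ CARD('d))"
  have G1: "1 \<le> G"
  proof -
    have "1 \<le> (4 * H + 1) ^ CARD('d)" by simp
    then have "real 1 \<le> G" unfolding G_def by (rule of_nat_mono)
    then show ?thesis by simp
  qed
  \<comment> \<open>With u = n / K and about c' u separated bad blocks, the charge
    \<open>2 * C * K * P * (c' * u)\<close> is exactly \<epsilon> n / 4.\<close>
  define c' where "c' = \<epsilon> / (8 * C * P)"
  have c': "0 < c'" using C1 P1 \<epsilon> by (simp add: c'_def)
  define \<Lambda> where "\<Lambda> = 2 * C * ln (4 * G)"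
  have \<Lambda>: "0 \<le> \<Lambda>" using C1 G1 by (simp add: \<Lambda>_def)
  \<comment> \<open>The chains contribute at most exp (\<Lambda> u) and the bad blocks about exp (-
    a c' u). The choice a c' = \<Lambda> + 1 leaves exp (- u).\<close>
  define a where "a = (\<Lambda> + 1) / c'"
  have a: "0 \<le> a" "a * c' = \<Lambda> + 1" using c' \<Lambda> by (simp_all add: a_def)
  define q where "q = exp (- a)"
  have q: "0 < q" "q \<le> 1" using a by (simp_all add: q_def)
  obtain N where N: "\<forall>\<^sub>F s in sequentially. N \<le> s \<and>
    (\<forall>L R v. (C + \<delta>) * L \<le> R \<longrightarrow> prob {w \<in> space M. bad \<delta> s L R N v (Z w)} \<le> q)"
    by (rule eventually_prob_bad_le[OF \<delta> q(1)])
  define s where "s n = nat \<lceil>n powr (3/4)\<rceil>" for n :: real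
  define E where "E = expectation (\<lambda>w. real (\<omega> w 0))"
  have E0: "0 \<le> E" by (simp add: E_def)
  have "filterlim s sequentially at_top" unfolding s_def by real_asymp
  from eventually_compose_filterlim[OF N this]
  have ev1: "\<forall>\<^sub>F n in at_top. N \<le> s n \<and>
    (\<forall>L R v. (C + \<delta>) * L \<le> R \<longrightarrow> prob {w \<in> space M. bad \<delta> (s n) L R N v (Z w)} \<le> q)" .
  have ev2: "\<forall>\<^sub>F n in at_top. 1 + C * real H * (n powr (3/4) + 1) < \<epsilon> * n / 2"
    using \<epsilon> by real_asymp
  have ev3: "\<forall>\<^sub>F n in at_top. (4 * C * n + 1) ^ CARD('d) * (E * exp (- (n powr (1/4)))
     + 2 * exp (n powr (1/4)) * (2 * C * n + 1) * (2 * d * exp (- (1 / (4 * C * d\<^sup>2) * (n powr (1/4))\<^sup>2))))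
     \<le> exp (- (n powr (1/4)) / 2)"
    using C1 d1 by (intro long_jump_bound_asymptotics) auto
  \<comment> \<open>Pays for rounding the number of bad blocks down to an integer.\<close>
  define Q where "Q = exp a"
  \<comment> \<open>From \<open>K \<le> 2 * H * y ^ 3\<close> and \<open>n = y ^ 4\<close>, where y
    = n powr (1/4), it follows that u \<ge> y / (2 H). Moreover \<kappa> \<le> 1 / 2 lets the same
    rate cover the long jumps.\<close>
  define \<kappa> where "\<kappa> = 1 / (2 * real H)"
  have \<kappa>: "0 < \<kappa>" "\<kappa> \<le> 1 / 2" using H3 d1 by (simp_all add: \<kappa>_def)
  have "\<forall>\<^sub>F n in at_top. \<forall>x. norm1 x = n \<longrightarrow>
      prob {w \<in> space M. fpt (\<omega> w) (S w) 0 x \<le> enat (nat \<lfloor>(1 - \<epsilon>) * m x\<rfloor> + 1)}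
        \<le> (1 + 2 * Q) * exp (- \<kappa> * n powr (1/4))"
    using ev1 ev2 ev3 eventually_ge_at_top[of 1]
  proof eventually_elim
    case (elim n)
    define y where "y = n powr (1/4)"
    define sn where "sn = s n"
    have n1: "1 \<le> n" by fact
    have y0: "0 < y" using n1 by (simp add: y_def)
    have pw: "n powr (3/4) = y ^ 3" "n = y ^ 4"
      using n1 by (simp_all add: y_def powr_powr flip: powr_realpow)
    have y1: "1 \<le> y" using n1 by (simp add: y_def ge_one_powr_ge_zero)
    have sn: "y ^ 3 \<le> real sn" "real sn \<le> y ^ 3 + 1"
      using y0 by (simp_all add: sn_def s_def pw(1))
    have y31: "1 \<le> y ^ 3" using y1 by simp
    have "1 \<le> real sn" using sn(1) y31 by linarith
    then have sn0: "0 < sn" by simp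
    define K where "K = real (H * sn)"
    define c where "c = real CARD('d) * (3 * real sn)"
    define L where "L = 2 * K + c"
    define R where "R = (C + \<delta>) * L"
    have K0: "0 < K" using sn0 H3 d1 by (simp add: K_def)
    define u where "u = n / K"
    have u0: "0 < u" using K0 n1 by (simp add: u_def)
    have K_ge: "y ^ 3 \<le> K"
    proof -
      have "1 * y ^ 3 \<le> real H * real sn" using sn H3 d1 y0 by (intro mult_mono) auto
      then show ?thesis by (simp add: K_def)
    qed
    have K_le: "K \<le> real H * (y ^ 3 + 1)" using sn by (simp add: K_def mult_left_mono)
    have u_ge: "\<kappa> * y \<le> u"
    proof -
      have "K \<le> real H * (2 * y ^ 3)" using y31 by (intro order_trans[OF K_le] mult_left_mono) auto
      then have "\<kappa> * y * K \<le> \<kappa> * y * (real H * (2 * y ^ 3))"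
        using \<kappa> y0 by (intro mult_left_mono) auto
      also have "\<dots> = y ^ 4" using H3 d1 by (simp add: \<kappa>_def eval_nat_numeral)
      finally show ?thesis using K0 pw(2) by (simp add: u_def pos_le_divide_eq)
    qed
    show ?case
    proof (intro allI impI)
      fix x :: "int^'d" assume nx: "norm1 x = n"
      \<comment> \<open>The added 1 guarantees \<open>0 < t\<close>, as the bound on long jumps
        requires.\<close>
      define t where "t = nat \<lfloor>(1 - \<epsilon>) * m x\<rfloor> + 1"
      define k where "k = nat \<lfloor>real t / K\<rfloor>"
      define b where "b = nat \<lfloor>c' * u\<rfloor>"
      have mx: "n \<le> m x" "m x \<le> C * n" using m_ge[of x] m_le[of x] nx by auto
      have r0: "0 \<le> (1 - \<epsilon>) * m x" using mx n1 \<epsilon> by simp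
      have t_le: "real t \<le> (1 - \<epsilon>) * m x + 1" unfolding t_def using r0 by linarith
      have "\<epsilon> * n \<le> \<epsilon> * m x" using mx \<epsilon> by simp
      then have t_le1: "real t \<le> m x - \<epsilon> * n + 1" using t_le by (simp add: algebra_simps)
      have t_le2: "real t \<le> 2 * C * n"
      proof -
        have "0 \<le> \<epsilon> * n" using \<epsilon> n1 by simp
        moreover have "1 * 1 \<le> C * n" using C1 n1 by (intro mult_mono) auto
        ultimately show ?thesis using t_le1 mx by linarith
      qed
      have t0: "0 < t" by (simp add: t_def)
      have k1: "real t < real (Suc k) * K"
      proof -
        have "real t / K < real (Suc k)" unfolding k_def using K0 by (simp, linarith)
        then show ?thesis using K0 by (simp add: pos_divide_less_eq)
      qed
      have k2: "real k * K \<le> 2 * C * n"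
      proof -
        have "real k \<le> real t / K" unfolding k_def using K0 by (intro of_nat_floor) auto
        then have "real k * K \<le> real t" using K0 by (simp add: pos_le_divide_eq)
        then show ?thesis using t_le2 by linarith
      qed
      have b1: "real b \<le> c' * u" unfolding b_def using c' u0 by (intro of_nat_floor) auto
      have b2: "c' * u - 1 \<le> real b" unfolding b_def by linarith
      have Kc: "K = real H * real sn" "c = 3 * d * real sn" by (simp_all add: K_def c_def d_def)
      have e_le: "2 * C * c + \<delta> * (2 * K + 2 * c) \<le> K * (\<epsilon> / (8 * C))"
      proof -
        have "2 * C * c = (6 * C * d) * real sn" by (simp add: Kc)
        also have "\<dots> \<le> (real H * (\<epsilon> / (16 * C))) * real sn" using H2 by (intro mult_right_mono) auto
        finally have 1: "2 * C * c \<le> K * (\<epsilon> / (16 * C))" by (simp add: Kc mult_ac)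
        have "c \<le> K" unfolding Kc using H3 by (intro mult_right_mono) auto
        then have "\<delta> * (2 * K + 2 * c) \<le> \<delta> * (4 * K)" using \<delta> by (intro mult_left_mono) auto
        also have "\<dots> = K * (\<epsilon> / (16 * C))" by (simp add: \<delta>_def)
        finally show ?thesis using 1 by (simp add: field_simps)
      qed
      have main: "real t + real k * (2 * C * c + \<delta> * (2 * K + 2 * c))
         + 2 * C * K * real (D ^ CARD('d) * b) + C * K < m x"
      proof -
        have "real k * (2 * C * c + \<delta> * (2 * K + 2 * c)) \<le> real k * (K * (\<epsilon> / (8 * C)))"
          using e_le by (intro mult_left_mono) auto
        also have "\<dots> = (real k * K) * (\<epsilon> / (8 * C))" by simp
        also have "\<dots> \<le> (2 * C * n) * (\<epsilon> / (8 * C))"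
          using k2 C1 \<epsilon> by (intro mult_right_mono) auto
        also have "\<dots> = \<epsilon> * n / 4" using C1 by simp
        finally have 1: "real k * (2 * C * c + \<delta> * (2 * K + 2 * c)) \<le> \<epsilon> * n / 4" .
        have "2 * C * K * real (D ^ CARD('d) * b) = (2 * C * K * P) * real b" by (simp add: P_def)
        also have "\<dots> \<le> (2 * C * K * P) * (c' * u)"
          using b1 C1 K0 P1 by (intro mult_left_mono) auto
        also have "\<dots> = \<epsilon> * n / 4" using C1 K0 P1 by (simp add: c'_def u_def)
        finally have 2: "2 * C * K * real (D ^ CARD('d) * b) \<le> \<epsilon> * n / 4" .
        have "C * K \<le> C * real H * (y ^ 3 + 1)"
          using K_le C1 by (simp add: mult.assoc mult_left_mono)
        then have 3: "1 + C * K < \<epsilon> * n / 2" using elim(2) unfolding pw(1) by linarith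
        show ?thesis using 1 2 3 t_le1 by linarith
      qed
      have D1: "2 * (R + 2 * real CARD('d) * real sn) < real (D * sn)"
      proof -
        have "2 * ((C + \<delta>) * (2 * real H + 3 * d) + 2 * d) < real D" unfolding D_def by linarith
        then have "2 * ((C + \<delta>) * (2 * real H + 3 * d) + 2 * d) * real sn < real D * real sn"
          using sn0 by simp
        then show ?thesis by (simp add: R_def L_def Kc d_def[symmetric] algebra_simps)
      qed
      have qs: "prob {w \<in> space M. bad \<delta> sn L R N v (Z w)} \<le> q" for v
        using elim(1) by (auto simp: sn_def R_def)
      have Nsn: "N \<le> sn" using elim(1) by (simp add: sn_def)
      have D0: "0 < D" by (simp add: D_def)
      have "prob {w \<in> space M. fpt (\<omega> w) (S w) 0 x \<le> enat t}
        \<le> prob {w \<in> space M. long_jump t K w} + 2 * (4 * G) ^ k * q ^ b"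
        by (rule prob_fast_passage_le[OF qs q(2) sn0 Nsn H1 _ _ _ D1 D0, folded K_def c_def G_def])
          (use \<delta> in \<open>auto simp only: L_def R_def order_refl less_imp_le intro: k1 main\<close>)
      moreover have "2 * (4 * G) ^ k * q ^ b \<le> 2 * Q * exp (- u)"
      proof -
        have G4: "0 < 4 * G" "0 \<le> ln (4 * G)" using G1 by auto
        have "(4 * G) ^ k = exp (real k * ln (4 * G))" using G4 by (simp add: exp_of_nat_mult)
        also have "\<dots> \<le> exp (\<Lambda> * u)"
        proof -
          have "real k \<le> 2 * C * u" using k2 K0 by (simp add: u_def pos_le_divide_eq)
          then have "real k * ln (4 * G) \<le> 2 * C * u * ln (4 * G)" using G4 by (intro mult_right_mono)
          then show ?thesis by (simp add: \<Lambda>_def mult_ac)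
        qed
        finally have 1: "(4 * G) ^ k \<le> exp (\<Lambda> * u)" .
        have "q ^ b = exp (- (a * real b))"
          by (simp add: q_def exp_of_nat_mult[symmetric] mult.commute)
        also have "\<dots> \<le> exp (- (a * (c' * u - 1)))"
          using b2 a by (simp add: mult_left_mono)
        also have "a * (c' * u - 1) = \<Lambda> * u + u - a"
          using a(2) by (simp add: right_diff_distrib mult.assoc[symmetric] distrib_right)
        also have "exp (- (\<Lambda> * u + u - a)) = Q * exp (- (\<Lambda> * u)) * exp (- u)"
          by (simp add: Q_def exp_add[symmetric])
        finally have "(4 * G) ^ k * q ^ b \<le> exp (\<Lambda> * u) * (Q * exp (- (\<Lambda> * u)) * exp (- u))"
          using 1 q by (intro mult_mono) auto
        also have "\<dots> = Q * exp (- u)" by (simp add: exp_minus)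
        finally show ?thesis by simp
      qed
      moreover have "exp (- u) \<le> exp (- \<kappa> * y)" using u_ge by simp
      then have "2 * Q * exp (- u) \<le> 2 * Q * exp (- \<kappa> * y)" by (intro mult_left_mono) (auto simp: Q_def)
      moreover have "prob {w \<in> space M. long_jump t K w} \<le> exp (- \<kappa> * y)"
      proof -
        \<comment> \<open>Markov's inequality then loses only \<open>E * exp (- y)\<close>, while a
          union bound over \<open>B\<close> walks is still beaten by the Gaussian term, whose
          exponent is of order y^2.\<close>
        define B where "B = nat \<lceil>exp y\<rceil>"
        have B1: "exp y \<le> real B" unfolding B_def by linarith
        have "0 < exp y" "1 \<le> exp y" using y0 by auto
        then have B0: "0 < B" "real B \<le> 2 * exp y" unfolding B_def by (simp, linarith)
        have "prob {w \<in> space M. long_jump t K w} \<le> real ((2 * t + 1) ^ CARD('d)) *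
           (E / real B + real B * (real t + 1) * (2 * d * exp (- (K / d)\<^sup>2 / (2 * real t))))"
          using prob_long_jump[OF K0 t0 B0(1)] by (simp add: E_def d_def)
        also have "\<dots> \<le> (4 * C * n + 1) ^ CARD('d) * (E * exp (- y)
           + 2 * exp y * (2 * C * n + 1) * (2 * d * exp (- (1 / (4 * C * d\<^sup>2) * y\<^sup>2))))"
        proof (rule mult_mono)
          have "(2 * real t + 1) ^ CARD('d) \<le> (4 * C * n + 1) ^ CARD('d)"
            using t_le2 by (intro power_mono) auto
          then show "real ((2 * t + 1) ^ CARD('d)) \<le> (4 * C * n + 1) ^ CARD('d)" by (simp add: add_ac)
          have "E / real B \<le> E / exp y" using B1 E0 B0 by (intro divide_left_mono) auto
          then have 1: "E / real B \<le> E * exp (- y)" by (simp add: exp_minus field_simps)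
          have "1 / (4 * C * d\<^sup>2) * y\<^sup>2 \<le> (K / d)\<^sup>2 / (2 * real t)"
          proof -
            have "1 / (4 * C * d\<^sup>2) * y\<^sup>2 = (y ^ 3 / d)\<^sup>2 / (2 * (2 * C * n))"
              using y0 C1 d1 by (simp add: pw(2) field_simps eval_nat_numeral)
            also have "\<dots> \<le> (K / d)\<^sup>2 / (2 * (2 * C * n))"
              using K_ge y0 d1 C1 n1 by (intro divide_right_mono power_mono) auto
            also have "\<dots> \<le> (K / d)\<^sup>2 / (2 * real t)"
              using t_le2 t0 C1 n1 by (intro divide_left_mono) auto
            finally show ?thesis .
          qed
          then have ex: "2 * d * exp (- (K / d)\<^sup>2 / (2 * real t))
              \<le> 2 * d * exp (- (1 / (4 * C * d\<^sup>2) * y\<^sup>2))" using d1 by simp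
          have "real B * (real t + 1) * (2 * d * exp (- (K / d)\<^sup>2 / (2 * real t)))
              \<le> 2 * exp y * (2 * C * n + 1) * (2 * d * exp (- (1 / (4 * C * d\<^sup>2) * y\<^sup>2)))"
            using B0 t_le2 ex d1 C1 n1 by (intro mult_mono) auto
          with 1 show "E / real B + real B * (real t + 1) * (2 * d * exp (- (K / d)\<^sup>2 / (2 * real t)))
             \<le> E * exp (- y) + 2 * exp y * (2 * C * n + 1) * (2 * d * exp (- (1 / (4 * C * d\<^sup>2) * y\<^sup>2)))"
            by linarith
          show "0 \<le> E / real B + real B * (real t + 1) * (2 * d * exp (- (K / d)\<^sup>2 / (2 * real t)))"
            using E0 d1 by (intro add_nonneg_nonneg mult_nonneg_nonneg divide_nonneg_nonneg) auto
        qed (use C1 n1 in auto)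
        also have "\<dots> \<le> exp (- y / 2)" using elim(3) unfolding y_def .
        also have "\<dots> \<le> exp (- \<kappa> * y)" using \<kappa> y0 by simp
        finally show ?thesis .
      qed
      ultimately have "prob {w \<in> space M. fpt (\<omega> w) (S w) 0 x \<le> enat t}
          \<le> (1 + 2 * Q) * exp (- \<kappa> * y)" by (simp add: distrib_right)
      then show "prob {w \<in> space M. fpt (\<omega> w) (S w) 0 x \<le> enat (nat \<lfloor>(1 - \<epsilon>) * m x\<rfloor> + 1)}
        \<le> (1 + 2 * Q) * exp (- \<kappa> * n powr (1/4))" by (simp add: t_def y_def)
    qed
  qed
  then obtain n0 where "\<And>n x. n0 \<le> n \<Longrightarrow> norm1 x = n \<Longrightarrow>
      prob {w \<in> space M. fpt (\<omega> w) (S w) 0 x \<le> enat (nat \<lfloor>(1 - \<epsilon>) * m x\<rfloor> + 1)}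
        \<le> (1 + 2 * Q) * exp (- \<kappa> * n powr (1/4))"
    unfolding eventually_at_top_linorder by blast
  then show thesis using \<kappa>(1) by (intro that[of "1 + 2 * Q" \<kappa> n0]) (auto simp: Q_def add_pos_pos)
qed

end

section \<open>The lower tail of the first passage time\<close>

lemma eventually_l1_at_infinity:
  "eventually P l1_at_infinity \<longleftrightarrow> (\<exists>n. \<forall>x. n \<le> norm1 x \<longrightarrow> P x)"
proof -
  have "eventually P l1_at_infinity \<longleftrightarrow> (\<exists>n\<in>UNIV. eventually P (principal {x. n \<le> norm1 x}))"
    unfolding l1_at_infinity_def
  proof (rule eventually_INF_base)
    fix a b :: real
    show "\<exists>x\<in>UNIV. principal {y. x \<le> norm1 y}
        \<le> inf (principal {y. a \<le> norm1 y}) (principal {y. b \<le> norm1 y})"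
      by (intro bexI[of _ "max a b"]) auto
  qed auto
  then show ?thesis by (simp add: eventually_principal)
qed

lemma norm_lat_to_real_le:
  fixes \<mu> :: "real^'d \<Rightarrow> real"
  assumes "\<And>v. \<mu> v = 0 \<longleftrightarrow> v = 0" "\<And>c v. \<mu> (c *\<^sub>R v) = \<bar>c\<bar> * \<mu> v"
    "\<And>u v. \<mu> (u + v) \<le> \<mu> u + \<mu> v" "\<And>v. \<mu> v \<ge> 0"
  shows "\<mu> (lat_to_real x) \<le> (\<Sum>i\<in>UNIV. \<mu> (axis i 1)) * norm1 x"
proof -
  have sum: "\<mu> (\<Sum>i\<in>I. f i) \<le> (\<Sum>i\<in>I. \<mu> (f i))" if "finite I" for I :: "'d set" and f
    using that
  proof (induction I rule: finite_induct)
    case (insert i I)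
    then show ?case using assms(3)[of "f i" "\<Sum>i\<in>I. f i"] by simp
  qed (use assms(1)[of 0] in simp)
  have "lat_to_real x = (\<Sum>i\<in>UNIV. real_of_int (x $ i) *\<^sub>R axis i 1)"
    by (simp add: lat_to_real_def vec_eq_iff axis_def if_distrib[of "(*) _"] cong: if_cong)
  then have "\<mu> (lat_to_real x) \<le> (\<Sum>i\<in>UNIV. \<mu> (real_of_int (x $ i) *\<^sub>R axis i 1))"
    using sum[of UNIV "\<lambda>i. real_of_int (x $ i) *\<^sub>R axis i 1"] by simp
  also have "\<dots> = (\<Sum>i\<in>UNIV. real_of_int \<bar>x $ i\<bar> * \<mu> (axis i 1))"
    by (simp add: assms(2))
  also have "\<dots> \<le> (\<Sum>i\<in>UNIV. norm1 x * \<mu> (axis i 1))"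
    by (intro sum_mono mult_right_mono abs_coord_le_norm1 assms(4))
  finally show ?thesis by (simp add: sum_distrib_left mult.commute)
qed

text \<open>The extended-real limit also encodes finiteness: an infinite \<open>T x\<close> would
  make the quotient infinite, hence not below \<open>\<delta>\<close>.\<close>

lemma time_constant_real:
  assumes lim: "((\<lambda>x. (ereal_of_enat (T x) - ereal (m x)) / ereal (norm1 x)) \<longlongrightarrow> 0) l1_at_infinity"
    and \<delta>: "0 < \<delta>"
  shows "\<exists>r. \<forall>x. r \<le> norm1 x \<longrightarrow> (\<exists>k. T x = enat k \<and> \<bar>real k - m x\<bar> \<le> \<delta> * norm1 x)"
proof -
  let ?f = "\<lambda>x. (ereal_of_enat (T x) - ereal (m x)) / ereal (norm1 x)"
  have "\<forall>\<^sub>F x in l1_at_infinity. ?f x < ereal \<delta> \<and> ereal (- \<delta>) < ?f x"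
    using order_tendstoD(1)[OF lim, of "ereal (- \<delta>)"] order_tendstoD(2)[OF lim, of "ereal \<delta>"] \<delta>
    by (intro eventually_conj) (auto simp: zero_ereal_def)
  then obtain n where n: "\<And>x. n \<le> norm1 x \<Longrightarrow> ?f x < ereal \<delta> \<and> ereal (- \<delta>) < ?f x"
    unfolding eventually_l1_at_infinity by blast
  \<comment> \<open>The bound 1 in the maximum keeps the denominator positive.\<close>
  have "\<exists>k. T x = enat k \<and> \<bar>real k - m x\<bar> \<le> \<delta> * norm1 x" if x: "max n 1 \<le> norm1 x" for x
  proof (cases "T x")
    case (enat k)
    have x0: "0 < norm1 x" using x by simp
    have "(real k - m x) / norm1 x < \<delta>" "- \<delta> < (real k - m x) / norm1 x"
      using n[of x] x enat x0 by auto
    then have "real k - m x < \<delta> * norm1 x" "- \<delta> * norm1 x < real k - m x"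
      using x0 by (simp_all add: pos_divide_less_eq pos_less_divide_eq)
    then show ?thesis using enat by (auto simp: abs_le_iff)
  next
    case infinity
    then show ?thesis using n[of x] x by simp
  qed
  then show ?thesis by blast
qed

theorem theorem1p3:
  fixes M :: "'a measure"
    and \<omega> :: "'a \<Rightarrow> int^'d \<Rightarrow> nat"
    and S :: "'a \<Rightarrow> int^'d \<Rightarrow> nat \<Rightarrow> nat \<Rightarrow> int^'d"
    and \<mu> :: "real^'d \<Rightarrow> real"
  assumes P: "prob_space M"
    and dim: "CARD('d) \<ge> 2"
    and indep: "prob_space.indep_vars M (\<lambda>_. count_space UNIV) (basic_rvs \<omega> S)
                  (range Inl \<union> Inr ` {(x, l, k). l \<ge> 1})"
    and ident: "\<And>x. distr M (count_space UNIV) (\<lambda>w. \<omega> w x)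
                    = distr M (count_space UNIV) (\<lambda>w. \<omega> w 0)"
    and nondeg: "measure M {w \<in> space M. \<omega> w 0 \<noteq> 0} > 0"
    and start: "\<And>w x l. w \<in> space M \<Longrightarrow> S w x l 0 = x"
    and srw: "\<And>x l k. l \<ge> 1 \<Longrightarrow>
               distr M (count_space UNIV) (\<lambda>w. S w x l (Suc k) - S w x l k)
                 = measure_pmf (pmf_of_set {e :: int^'d. norm1 e = 1})"
    and mean: "integrable M (\<lambda>w. real (\<omega> w 0))"
    and mu_norm: "\<And>v. \<mu> v \<ge> 0" "\<And>v. \<mu> v = 0 \<longleftrightarrow> v = 0"
                 "\<And>c v. \<mu> (c *\<^sub>R v) = \<bar>c\<bar> * \<mu> v" "\<And>u v. \<mu> (u + v) \<le> \<mu> u + \<mu> v"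
    and time_const: "AE w in M. \<omega> w 0 \<ge> 1 \<longrightarrow>
        ((\<lambda>x. (ereal_of_enat (fpt (\<omega> w) (S w) 0 x) - ereal (\<mu> (lat_to_real x)))
               / ereal (norm1 x)) \<longlongrightarrow> 0) l1_at_infinity"
  shows "\<exists>\<alpha>::real. 0 < \<alpha> \<and> \<alpha> < 1 \<and> (\<forall>\<epsilon>>0.
           Limsup l1_at_infinity (\<lambda>x.
             eln (cond_prob M
                    (\<lambda>w. ereal_of_enat (fpt (\<omega> w) (S w) 0 x) \<le> ereal ((1 - \<epsilon>) * \<mu> (lat_to_real x)))
                    (\<lambda>w. \<omega> w 0 \<ge> 1))
             / ereal (norm1 x powr \<alpha>)) < 0)"
proof -
  interpret prob_space M by (rule P)
  define m where "m x = \<mu> (lat_to_real x)" for x :: "int^'d"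
  \<comment> \<open>The sum alone already bounds \<open>m\<close> by a multiple of
    \<open>norm1\<close>; the summand 1 secures \<open>1 \<le> C\<close>.\<close>
  define C where "C = 1 + (\<Sum>i\<in>UNIV. \<mu> (axis i 1))"
  have C1: "1 \<le> C" using mu_norm(1) by (simp add: C_def sum_nonneg)
  have "range Inl \<union> Inr ` {(x, l, k). l \<ge> 1} = (site_idx UNIV :: ((int^'d) + ((int^'d) \<times> nat \<times> nat)) set)"
    by (auto simp: site_idx_def)
  note indep' = indep[unfolded this]
  interpret frog_time_constant M \<omega> S m C
  proof unfold_locales
    show "indep_vars (\<lambda>_. count_space UNIV) (basic_rvs \<omega> S) (site_idx UNIV)" by (rule indep')
    fix x y :: "int^'d"
    have "lat_to_real (x + y) = lat_to_real x + lat_to_real y" "lat_to_real (- x) = - 1 *\<^sub>R lat_to_real x"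
      by (simp_all add: lat_to_real_def vec_eq_iff)
    then show "m (x + y) \<le> m x + m y" "m (- x) = m x"
      unfolding m_def using mu_norm(3)[of "- 1"] mu_norm(4) by simp_all
    show "m x \<le> C * norm1 x"
      using norm_lat_to_real_le[of \<mu> x, OF mu_norm(2,3,4,1)] norm1_nonneg[of x]
      unfolding m_def C_def distrib_right by linarith
    show "0 \<le> C" using C1 by simp
    fix \<delta> :: real assume "0 < \<delta>"
    show "AE w in M. 1 \<le> \<omega> w 0 \<longrightarrow>
      (\<exists>r. \<forall>x. r \<le> norm1 x \<longrightarrow>
        (\<exists>k. fpt (\<omega> w) (S w) 0 x = enat k \<and> \<bar>real k - m x\<bar> \<le> \<delta> * norm1 x))"
      using time_const by eventually_elim (use time_constant_real \<open>0 < \<delta>\<close> in \<open>auto simp: m_def\<close>)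
  qed (use ident nondeg start srw mean in auto)
  have m_ge: "norm1 x \<le> m x" for x
  proof (rule norm1_le_m)
    fix k
    have "lat_to_real (\<chi> i. int k * x $ i) = real k *\<^sub>R lat_to_real x"
      by (simp add: lat_to_real_def vec_eq_iff)
    then show "m (\<chi> i. int k * x $ i) = real k * m x" by (simp add: m_def mu_norm(3))
  qed
  let ?p = "prob {w \<in> space M. \<omega> w 0 \<ge> 1}"
  have p0: "0 < ?p" using nondeg by (simp add: Suc_le_eq)
  have "Limsup l1_at_infinity (\<lambda>x.
           eln (cond_prob M
                  (\<lambda>w. ereal_of_enat (fpt (\<omega> w) (S w) 0 x) \<le> ereal ((1 - \<epsilon>) * \<mu> (lat_to_real x)))
                  (\<lambda>w. \<omega> w 0 \<ge> 1))
           / ereal (norm1 x powr (1/4))) < 0" if "0 < \<epsilon>" for \<epsilon>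
  proof -
    \<comment> \<open>Lowering \<open>\<epsilon>\<close> enlarges the event, so it is enough to
      treat values below 1.\<close>
    define \<epsilon>' where "\<epsilon>' = min \<epsilon> (1/2)"
    have \<epsilon>': "0 < \<epsilon>'" "\<epsilon>' < 1" "\<epsilon>' \<le> \<epsilon>" using that by (auto simp: \<epsilon>'_def)
    obtain A \<kappa> n0 where A: "0 < A" and \<kappa>: "0 < \<kappa>" and bound: "\<And>x. n0 \<le> norm1 x \<Longrightarrow>
        prob {w \<in> space M. fpt (\<omega> w) (S w) 0 x \<le> enat (nat \<lfloor>(1 - \<epsilon>') * m x\<rfloor> + 1)}
          \<le> A * exp (- \<kappa> * norm1 x powr (1/4))"
      using prob_fast_passage_exponential[OF C1 m_ge \<epsilon>'(1,2)] by blast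
    have "\<forall>\<^sub>F n in at_top. B \<le> (\<kappa> / 2) * n powr (1/4)" for B :: real
      using \<kappa> by real_asymp
    \<comment> \<open>Half of the rate absorbs the constant, including the factor
      \<open>1 / ?p\<close> caused by conditioning on an occupied origin; the other half survives as
      the final bound.\<close>
    from this[of "ln (A / ?p)"] obtain n1 where n1: "\<And>n. n1 \<le> n \<Longrightarrow> ln (A / ?p) \<le> (\<kappa> / 2) * n powr (1/4)"
      unfolding eventually_at_top_linorder by blast
    define F where "F x = cond_prob M
        (\<lambda>w. ereal_of_enat (fpt (\<omega> w) (S w) 0 x) \<le> ereal ((1 - \<epsilon>) * \<mu> (lat_to_real x)))
        (\<lambda>w. \<omega> w 0 \<ge> 1)" for x
    have "eln (F x) / ereal (norm1 x powr (1/4)) \<le> ereal (- (\<kappa> / 2))"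
      if x: "max 1 (max n0 n1) \<le> norm1 x" for x
    proof -
      define y where "y = norm1 x powr (1/4)"
      have y0: "0 < y" using x by (simp add: y_def)
      have "{w \<in> space M. ereal_of_enat (fpt (\<omega> w) (S w) 0 x) \<le> ereal ((1 - \<epsilon>) * m x) \<and> \<omega> w 0 \<ge> 1}
          \<subseteq> {w \<in> space M. fpt (\<omega> w) (S w) 0 x \<le> enat (nat \<lfloor>(1 - \<epsilon>') * m x\<rfloor> + 1)}"
      proof clarify
        fix w assume le: "ereal_of_enat (fpt (\<omega> w) (S w) 0 x) \<le> ereal ((1 - \<epsilon>) * m x)"
        then obtain k where k: "fpt (\<omega> w) (S w) 0 x = enat k" "real k \<le> (1 - \<epsilon>) * m x"
          by (cases "fpt (\<omega> w) (S w) 0 x") auto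
        have "(1 - \<epsilon>) * m x \<le> (1 - \<epsilon>') * m x"
          using \<epsilon>'(3) m_ge[of x] norm1_nonneg[of x] by (intro mult_right_mono) linarith+
        then have "real k \<le> (1 - \<epsilon>') * m x" using k(2) by linarith
        then have "k \<le> nat \<lfloor>(1 - \<epsilon>') * m x\<rfloor> + 1" by linarith
        then show "fpt (\<omega> w) (S w) 0 x \<le> enat (nat \<lfloor>(1 - \<epsilon>') * m x\<rfloor> + 1)" using k(1) by simp
      qed
      moreover have "{w \<in> space M. fpt (\<omega> w) (S w) 0 x \<le> enat (nat \<lfloor>(1 - \<epsilon>') * m x\<rfloor> + 1)} \<in> events"
      proof -
        have "Measurable.pred M (\<lambda>w. config_fpt (Z w) 0 x \<le> enat (nat \<lfloor>(1 - \<epsilon>') * m x\<rfloor> + 1))"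
          by (rule measurable_compose[OF measurable_config_fpt[of Z, OF measurable_Z]]) simp
        then show ?thesis by (simp add: pred_def config_fpt_Z cong: conj_cong)
      qed
      ultimately have "prob {w \<in> space M. ereal_of_enat (fpt (\<omega> w) (S w) 0 x)
          \<le> ereal ((1 - \<epsilon>) * m x) \<and> \<omega> w 0 \<ge> 1}
        \<le> prob {w \<in> space M. fpt (\<omega> w) (S w) 0 x \<le> enat (nat \<lfloor>(1 - \<epsilon>') * m x\<rfloor> + 1)}"
        by (rule finite_measure_mono)
      also have "\<dots> \<le> A * exp (- \<kappa> * y)"
        unfolding y_def by (rule bound) (use x in simp)
      finally have F_le: "F x \<le> (A / ?p) * exp (- \<kappa> * y)"
        using p0 by (simp add: F_def cond_prob_def m_def divide_right_mono)
      have F0: "0 \<le> F x" by (simp add: F_def cond_prob_def)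
      show ?thesis
      proof (cases "F x = 0")
        \<comment> \<open>Here \<open>eln\<close> takes the value -\<infinity>, and division by a
          positive real preserves it.\<close>
        case True
        then show ?thesis using y0 by (simp add: eln_def y_def)
      next
        case False
        then have Fpos: "0 < F x" using F0 by simp
        then have "ln (F x) \<le> ln ((A / ?p) * exp (- \<kappa> * y))" using F_le A p0 by simp
        also have "\<dots> = ln (A / ?p) - \<kappa> * y" using A p0 by (simp add: ln_mult ln_div)
        also have "\<dots> \<le> - (\<kappa> / 2) * y" using n1[of "norm1 x"] x by (simp add: y_def)
        finally have "ln (F x) / y \<le> - (\<kappa> / 2)" using y0 by (simp add: pos_divide_le_eq)
        then show ?thesis using False y0 by (simp add: eln_def y_def)
      qed
    qed
    then have "\<forall>\<^sub>F x in l1_at_infinity. eln (F x) / ereal (norm1 x powr (1/4)) \<le> ereal (- (\<kappa> / 2))"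
      unfolding eventually_l1_at_infinity by blast
    then have "Limsup l1_at_infinity (\<lambda>x. eln (F x) / ereal (norm1 x powr (1/4))) \<le> ereal (- (\<kappa> / 2))"
      by (rule Limsup_bounded)
    also have "\<dots> < 0" using \<kappa> by (simp add: zero_ereal_def)
    finally show ?thesis unfolding F_def .
  qed
  then show ?thesis by (intro exI[of _ "1/4"]) auto
qed

end
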